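(* Let $S=\langle n_1,n_2,n_3,n_4\rangle$ be a 4-generated pseudo-symmetric numerical semigroup with $n_1<n_2<n_3<n_4$, with associated integers $\alpha_1,\alpha_2,\alpha_3,\alpha_4,\alpha_{21}$, and suppose $\alpha_2>\alpha_{21}+1$. Let $P(I_S^* )$ denote the numerator of the Hilbert series of the local ring $R_S$, i.e. $HS_{R_S}(t)=P(I_S^* )/(1-t)^4$. Then $$\begin{aligned} P(I_S^* )={}&1-t^{\alpha_4}-t^{\alpha_4}(1-t)(1-t^{\alpha_{21}})-t^{((\alpha_4-1)s_{\alpha_4-1}+\alpha_4-1)\alpha_2+1}(1-t)^2-(1-t)\sum_{j=1}^{\alpha_4-1}t^{j\alpha_2+(\alpha_4-j)}\\ &-t^{\alpha_{21}+1}\Big[1-t^{(\alpha_4-2)\alpha_2+1}-(1-t^{\alpha_2})\sum_{j=0}^{\alpha_4-3}t^{j\alpha_2+(\alpha_4-1-j)}\Big]\\ &-(1-t)^2(1-t^{\alpha_{21}})\sum_{j=0}^{\alpha_4-2}t^{((\alpha_4-1)s_j+j)\alpha_2+\alpha_4-j}\\ &-(1-t^{(\alpha_4-1)\alpha_2})(1-t)^2\Big[\sum_{i=1}^{\alpha_4-1}\sum_{j=s_{i-1}}^{s_i-1}t^{j\alpha_1+((\alpha_4-1)j+(i+1))\alpha_{21}+\alpha_3-j}\Big]\\ &-t^{\alpha_3}\Big[(1-t^{\alpha_{21}+1})(1-t^{(\alpha_4-1)\alpha_2})-(1-t^{\alpha_2})(1-t^{\alpha_{21}})\sum_{j=0}^{\alpha_4-2}t^{j\alpha_2+(\alpha_4-1-j)}\Big].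 \end{aligned}$$
   Context: $K$ is an algebraically closed field. For positive integers $n_1<n_2<n_3<n_4$ with $\gcd=1$, $S=\langle n_1,\dots,n_4\rangle=\{\sum u_in_i: u_i\in\mathbb N\}$; $I_S$ is the kernel of $K[X_1,\dots,X_4]\to K[t]$, $X_i\mapsto t^{n_i}$; $I_S^*$ is the ideal generated by the least-degree homogeneous summands $f^*$ of all $f\in I_S$. $R_S=K[[t^{n_1},\dots,t^{n_4}]]$ with maximal ideal $\mathfrak m=\langle t^{n_1},\dots,t^{n_4}\rangle$, and $gr_{\mathfrak m}(R_S)=\bigoplus_{i\ge0}\mathfrak m^i/\mathfrak m^{i+1}\cong K[X_1,\dots,X_4]/I_S^*$. The Hilbert function is $H_{R_S}(n)=\dim_{R_S/\mathfrak m}(\mathfrak m^n/\mathfrak m^{n+1})$ and the Hilbert series is $HS_{R_S}(t)=\sum_{n\ge0}H_{R_S}(n)t^n$. By Komeda, a 4-generated semigroup $S$ is pseudo-symmetric if and only if there are integers $\alpha_i>1$ ($1\le i\le 4$) and $\alpha_{21}$ with $0<\alpha_{21}<\alpha_1-1$ such that $n_1=\alpha_2\alpha_3(\alpha_4-1)+1$, $n_2=\alpha_{21}\alpha_3\alpha_4+(\alpha_1-\alpha_{21}-1)(\alpha_3-1)+\alpha_3$, $n_3=\alpha_1\alpha_4+(\alpha_1-\alpha_{21}-1)(\alpha_2-1)(\alpha_4-1)-\alpha_4+1$, $n_4=\alpha_1\alpha_2(\alpha_3-1)+\alpha_{21}(\alpha_2-1)+\alpha_2$. These are the integers used in the claim.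 Put $s_{-1}=0$ and, for $j=0,1,\dots,\alpha_4-1$, let $s_j$ be the smallest non-negative integer with $((\alpha_4-1)s_j+j)\alpha_2+\alpha_4-j< s_j\alpha_1+((\alpha_4-1)s_j+j+1)\alpha_{21}+\alpha_3-s_j$. Empty sums are $0$. *)

theory Defs
  imports
    "HOL-Computational_Algebra.Computational_Algebra"
    "HOL-Algebra.Ideal_Product"
    "HOL-Algebra.QuotRing"
    "Jordan_Normal_Form.Missing_VectorSpace"
begin

section \<open>Numerical semigroups\<close>

definition semigroup_of :: "nat set \<Rightarrow> nat set" where
  "semigroup_of A = {\<Sum>a\<in>A. u a * a | u :: nat \<Rightarrow> nat. True}"

definition minimal_generators :: "nat set \<Rightarrow> bool" where
  "minimal_generators A \<longleftrightarrow> (\<forall>a\<in>A. a \<notin> semigroup_of (A - {a}))"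

text \<open>Meaningful only for a cofinite \<open>S \<noteq> \<nat>\<close> (the Frobenius number of \<open>\<nat>\<close> itself would be \<open>-1\<close>).\<close>

definition frobenius_number :: "nat set \<Rightarrow> nat" where
  "frobenius_number S = Max (- S)"

text \<open>
  The usual definition lets \<open>x\<close> range over the integers outside \<open>S\<close>.  For negative \<open>x\<close> the condition
  is void, since \<open>F - x > F\<close> lies in \<open>S\<close>; for \<open>x \<notin> S\<close> one has \<open>x \<le> F\<close>, so the subtraction
  below is the one of the integers.
\<close>

definition pseudo_symmetric :: "nat set \<Rightarrow> bool" where
  "pseudo_symmetric S \<longleftrightarrow>
     S \<noteq> UNIV \<and> even (frobenius_number S) \<and>
     (\<forall>x. x \<notin> S \<longrightarrow> 2 * x = frobenius_number S \<or> frobenius_number S - x \<in> S)"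


section \<open>The local ring of a semigroup\<close>

text \<open>
  \<open>K[[t\<^sup>a : a \<in> A]]\<close>, the set of power series \<open>\<Sum>\<^sub>u c\<^sub>u \<Prod>\<^sub>a (t\<^sup>a)\<^bsup>u(a)\<^esup>\<close> over all exponent vectors
  \<open>u\<close>, as a subring of \<open>K[[t]]\<close>.  For a finite set \<open>A\<close> of positive integers the sum defining the
  \<open>d\<close>-th coefficient is finite.
\<close>

definition semigroup_ring :: "nat set \<Rightarrow> 'k::field fps ring" where
  "semigroup_ring A =
     \<lparr>carrier = {Abs_fps (\<lambda>d. \<Sum>u \<in> {u \<in> A \<rightarrow>\<^sub>E UNIV. (\<Sum>a\<in>A. u a * a) = d}. c u)
                  | c :: (nat \<Rightarrow> nat) \<Rightarrow> 'k. True},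
      mult = (*), one = 1, zero = 0, add = (+)\<rparr>"

definition semigroup_max_ideal :: "nat set \<Rightarrow> 'k::field fps set" where
  "semigroup_max_ideal A = Idl\<^bsub>semigroup_ring A\<^esub> ((\<lambda>a. fps_X ^ a) ` A)"


section \<open>Hilbert function and Hilbert series\<close>

definition ideal_pow :: "('a, 'b) ring_scheme \<Rightarrow> 'a set \<Rightarrow> nat \<Rightarrow> 'a set" where
  "ideal_pow R I n = I [^]\<^bsub>ideals_set R\<^esub> n"

text \<open>
  \<open>I\<^sup>n / I\<^bsup>n+1\<^esup>\<close> as a module over \<open>R Quot I\<close>; a scalar \<open>I + r\<close> sends \<open>I\<^bsup>n+1\<^esup> + x\<close> to \<open>I\<^bsup>n+1\<^esup> + r x\<close>,
  which is what \<^const>\<open>rcoset_mult\<close> for \<open>I\<^bsup>n+1\<^esup>\<close> computes also when the left argument is a coset of \<open>I\<close>.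
  The fields \<open>mult\<close> and \<open>one\<close> are irrelevant to the module structure.
\<close>

definition graded_piece :: "('a, 'b) ring_scheme \<Rightarrow> 'a set \<Rightarrow> nat \<Rightarrow> ('a set, 'a set) module" where
  "graded_piece R I n = (let J = ideal_pow R I (Suc n) in
     \<lparr>carrier = (\<lambda>x. J +>\<^bsub>R\<^esub> x) ` ideal_pow R I n,
      mult = rcoset_mult R J, one = J +>\<^bsub>R\<^esub> \<one>\<^bsub>R\<^esub>, zero = J, add = set_add R,
      smult = rcoset_mult R J\<rparr>)"

definition hilbert_function :: "('a, 'b) ring_scheme \<Rightarrow> 'a set \<Rightarrow> nat \<Rightarrow> nat" where
  "hilbert_function R I n = vectorspace.dim (R Quot I) (graded_piece R I n)"

definition hilbert_series :: "('a, 'b) ring_scheme \<Rightarrow> 'a set \<Rightarrow> rat fps" where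
  "hilbert_series R I = Abs_fps (\<lambda>n. of_nat (hilbert_function R I n))"


section \<open>The auxiliary numbers \<open>s\<^sub>j\<close>\<close>

text \<open>For \<open>j < \<alpha>4\<close> and \<open>\<alpha>1 > 0\<close> no natural-number subtraction here truncates.\<close>

definition s_index :: "nat \<Rightarrow> nat \<Rightarrow> nat \<Rightarrow> nat \<Rightarrow> nat \<Rightarrow> nat \<Rightarrow> nat" where
  "s_index \<alpha>1 \<alpha>2 \<alpha>3 \<alpha>4 \<alpha>21 j =
     (LEAST s. ((\<alpha>4 - 1) * s + j) * \<alpha>2 + \<alpha>4 - j
             < s * \<alpha>1 + ((\<alpha>4 - 1) * s + j + 1) * \<alpha>21 + \<alpha>3 - s)"

end

theory Submission
  imports Defs
begin

text \<open>
  The ideal \<open>\<mm>\<^sup>n\<close> consists of the series supported on the elements \<open>x\<close> of \<open>S\<close> that are sums of at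
  least \<open>n\<close> generators.  Call the largest possible number of summands the order of \<open>x\<close>.  The
  monomials \<open>t\<^sup>x\<close> with \<open>x\<close> of order exactly \<open>n\<close> are a basis of \<open>\<mm>\<^sup>n / \<mm>\<^bsup>n+1\<^esup>\<close>, so the Hilbert series
  is the sum of \<open>t\<close> to the order of \<open>x\<close> over all \<open>x \<in> S\<close> (\<open>hilbert_function_semigroup_ring\<close>).

  To sum it, one longest factorization is singled out for each \<open>x\<close>.  Write a factorization as a
  monomial in \<open>X1, ..., X4\<close>.  Komeda's formulas make five binomials vanish at \<open>X_i = t^(n_i)\<close>:
  \<^item> \<open>X1^\<alpha>1 - X3 X4^(\<alpha>4-1)\<close>,
  \<^item> \<open>X2^\<alpha>2 - X1^\<alpha>21 X4\<close>,
  \<^item> \<open>X3^\<alpha>3 - X1^(\<alpha>1-\<alpha>21-1) X2\<close>,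
  \<^item> \<open>X4^\<alpha>4 - X1 X2^(\<alpha>2-1) X3^(\<alpha>3-1)\<close>,
  \<^item> \<open>X1^(\<alpha>21+1) X3^(\<alpha>3-1) - X2 X4^(\<alpha>4-1)\<close>.

  Since \<open>\<alpha>2 > \<alpha>21 + 1\<close>, the second one allows \<open>X1^\<alpha>21 X4\<close> to be replaced by something longer.
  Combining it repeatedly with the first and the last gives, for \<open>i < \<alpha>4\<close>, the relations
  \<^item> \<open>X2^(i \<alpha>2) X3 X4^(\<alpha>4-1-i) = X1^(\<alpha>1 + i \<alpha>21)\<close>,
  \<^item> \<open>X2^(((\<alpha>4-1) j + i) \<alpha>2 + 1) X4^(\<alpha>4-1-i) = X1^(j \<alpha>1 + ((\<alpha>4-1) j + i+1) \<alpha>21 + 1) X3^(\<alpha>3-1-j)\<close>.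

  In the last family the right-hand side is the shorter or an equally long one for \<open>j < s_i\<close>, and
  the longer one for \<open>j = s_i\<close>: that is what \<open>s_i\<close> measures.  Deleting all multiples of the side
  that is not preferred leaves the set of standard monomials, the complement of the initial ideal.
  A longest factorization, with the least exponent of \<open>X1\<close> among these, admits no further
  replacement, hence is standard (\<open>standard_representation\<close>).

  That standard monomials of equal value coincide (\<open>inj_val_standard\<close>) follows from a second choice
  of factorizations, those with the largest exponent of \<open>X1\<close>.  Their parts in \<open>X2, X3, X4\<close> lie in a set of \<open>\<alpha>2 \<alpha>3 (\<alpha>4-1) + 1 = n1\<close> monomials.  As the
  greatest common divisor of the generators is 1, these represent all residues modulo \<open>n1\<close>, hence
  each residue exactly once, and such factorizations are unique.  Rewriting a standard monomial into
  this form loses no information.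

  For fixed exponents of \<open>X3\<close> and \<open>X4\<close> the standard monomials form a rectangle.  Summing the
  generating functions of these rectangles, and using \<open>s_0 = 0\<close>, which is forced by the order of
  the generators, gives the formula after geometric summation (\<open>hilbert_numerator\<close>).
\<close>


section \<open>The order of an element of a semigroup\<close>

text \<open>
  Working with this predicate instead of the order itself avoids a maximum over factorizations, and
  covers \<open>x\<close> outside the semigroup, for which it is false.
\<close>
definition order_ge :: "nat set \<Rightarrow> nat \<Rightarrow> nat \<Rightarrow> bool" where
  "order_ge A n x \<longleftrightarrow> (\<exists>u. (\<Sum>a\<in>A. u a * a) = x \<and> n \<le> (\<Sum>a\<in>A. u a))"

lemma order_ge_0_iff: "order_ge A 0 x \<longleftrightarrow> x \<in> semigroup_of A"
  by (auto simp: order_ge_def semigroup_of_def)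

lemma order_ge_mono: "order_ge A n x \<Longrightarrow> m \<le> n \<Longrightarrow> order_ge A m x"
  unfolding order_ge_def using order_trans by blast

lemma order_ge_add:
  assumes "order_ge A m x" "order_ge A n y"
  shows "order_ge A (m + n) (x + y)"
proof -
  from assms obtain u v where
    "(\<Sum>a\<in>A. u a * a) = x" "m \<le> (\<Sum>a\<in>A. u a)" "(\<Sum>a\<in>A. v a * a) = y" "n \<le> (\<Sum>a\<in>A. v a)"
    unfolding order_ge_def by blast
  then show ?thesis
    unfolding order_ge_def by (intro exI[of _ "\<lambda>a. u a + v a"]) (auto simp: sum.distrib distrib_right)
qed

lemma order_ge_zero: "order_ge A 0 0"
  unfolding order_ge_def by (intro exI[of _ "\<lambda>_. 0"]) auto

lemma order_ge_generator:
  assumes "finite A" "a \<in> A"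
  shows "order_ge A (Suc 0) a"
proof -
  have "(\<Sum>x\<in>A. (if x = a then 1 else 0) * x) = a" "(\<Sum>x\<in>A. if x = a then 1 else 0) = (1::nat)"
    using assms by (simp_all add: if_distrib[of "\<lambda>z. z * _"] cong: if_cong)
  then show ?thesis
    unfolding order_ge_def by (intro exI[of _ "\<lambda>x. if x = a then 1 else 0"]) simp
qed

lemma order_ge_SucE:
  assumes "finite A" "order_ge A (Suc n) x"
  obtains a y where "a \<in> A" "x = a + y" "order_ge A n y"
proof -
  obtain u where u: "(\<Sum>a\<in>A. u a * a) = x" "Suc n \<le> (\<Sum>a\<in>A. u a)"
    using assms(2) unfolding order_ge_def by blast
  then obtain a where a: "a \<in> A" "u a > 0"
    by (metis Suc_n_not_le_n bot_nat_0.not_eq_extremum le_zero_eq nat.distinct(1) sum.neutral)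
  define v where "v = u(a := u a - 1)"
  have "(\<Sum>x\<in>A. u x * x) = a + (\<Sum>x\<in>A. v x * x)" "(\<Sum>x\<in>A. u x) = 1 + (\<Sum>x\<in>A. v x)"
    unfolding sum.remove[OF assms(1) a(1), of "\<lambda>x. u x * x"]
      sum.remove[OF assms(1) a(1), of "\<lambda>x. v x * x"]
      sum.remove[OF assms(1) a(1), of "\<lambda>x. u x"]
      sum.remove[OF assms(1) a(1), of "\<lambda>x. v x"]
    using a(2) by (cases "u a"; simp add: v_def)+
  with u have "x = a + (\<Sum>x\<in>A. v x * x)" "order_ge A n (\<Sum>x\<in>A. v x * x)"
    unfolding order_ge_def by auto
  with a(1) that show ?thesis by blast
qed

lemma order_ge_1_iff:
  assumes "finite A" "0 \<notin> A"
  shows "order_ge A (Suc 0) x \<longleftrightarrow> x \<noteq> 0 \<and> x \<in> semigroup_of A"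
proof
  assume *: "order_ge A (Suc 0) x"
  then obtain a y where "a \<in> A" "x = a + y" by (rule order_ge_SucE[OF assms(1)])
  with assms(2) have "x \<noteq> 0" by (metis add_is_0)
  with * show "x \<noteq> 0 \<and> x \<in> semigroup_of A"
    using order_ge_mono order_ge_0_iff by blast
next
  assume *: "x \<noteq> 0 \<and> x \<in> semigroup_of A"
  then obtain u where u: "x = (\<Sum>a\<in>A. u a * a)" by (auto simp: semigroup_of_def)
  with * have "(\<Sum>a\<in>A. u a) \<noteq> 0" using assms(1) by (auto simp: sum_eq_0_iff)
  with u show "order_ge A (Suc 0) x" unfolding order_ge_def by (auto intro!: exI[of _ u])
qed

text \<open>
  A sum of exactly \<open>n\<close> generators is at most \<open>n\<close> times the largest one, so every graded piece will
  turn out to be finite-dimensional.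
\<close>
lemma finite_order_eq:
  assumes "finite A"
  shows "finite {x. order_ge A n x \<and> \<not> order_ge A (Suc n) x}"
proof (rule finite_subset)
  show "{x. order_ge A n x \<and> \<not> order_ge A (Suc n) x} \<subseteq> {..n * Max A}"
  proof safe
    fix x assume "order_ge A n x" "\<not> order_ge A (Suc n) x"
    then obtain u where u: "(\<Sum>a\<in>A. u a * a) = x" "(\<Sum>a\<in>A. u a) \<le> n"
      unfolding order_ge_def by (metis not_less_eq_eq)
    have "x \<le> (\<Sum>a\<in>A. u a * Max A)"
      unfolding u(1)[symmetric] using assms by (intro sum_mono) auto
    also have "\<dots> = (\<Sum>a\<in>A. u a) * Max A" by (simp add: sum_distrib_right)
    also have "\<dots> \<le> n * Max A" using u(2) by simp
    finally show "x \<le> n * Max A" .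
  qed
qed simp


section \<open>Powers of the maximal ideal\<close>

text \<open>
  The filtration of the power series ring by order; its \<open>n\<close>-th member will be identified with the
  \<open>n\<close>-th power of the maximal ideal, and its member for \<open>n = 0\<close> with the semigroup ring.
\<close>
definition order_ideal :: "nat set \<Rightarrow> nat \<Rightarrow> 'k::field fps set" where
  "order_ideal A n = {f. \<forall>x. fps_nth f x \<noteq> 0 \<longrightarrow> order_ge A n x}"

text \<open>
  A series supported on the semigroup is obtained by putting each coefficient on one chosen
  factorization of its exponent and 0 on all others.
\<close>
lemma carrier_semigroup_ring:
  assumes "finite A" "0 \<notin> A"
  shows "carrier (semigroup_ring A) = (order_ideal A 0 :: 'k::field fps set)"
proof -
  let ?F = "\<lambda>d. {u \<in> A \<rightarrow>\<^sub>E UNIV. (\<Sum>a\<in>A. u a * a) = d}"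
  have fin: "finite (?F d)" for d
  proof (rule finite_subset)
    show "?F d \<subseteq> A \<rightarrow>\<^sub>E {..d}"
    proof
      fix u assume u: "u \<in> ?F d"
      have "u a \<le> (\<Sum>a\<in>A. u a * a)" if "a \<in> A" for a
      proof -
        have "u a \<le> u a * a" using that assms(2) by (cases a) auto
        also have "\<dots> \<le> (\<Sum>a\<in>A. u a * a)" by (rule member_le_sum) (use that assms in auto)
        finally show ?thesis .
      qed
      with u show "u \<in> A \<rightarrow>\<^sub>E {..d}" by (auto simp: PiE_iff)
    qed
    show "finite (A \<rightarrow>\<^sub>E {..d})" using assms by (intro finite_PiE) auto
  qed
  have ne: "?F d \<noteq> {} \<longleftrightarrow> d \<in> semigroup_of A" for d
  proof -
    have "?F d \<noteq> {}" if "(\<Sum>a\<in>A. u a * a) = d" for u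
    proof -
      have "restrict u A \<in> ?F d" using that by auto
      then show ?thesis by blast
    qed
    then show ?thesis by (auto simp: semigroup_of_def)
  qed
  show ?thesis
  proof (intro subset_antisym subsetI)
    fix f :: "'k fps"
    assume "f \<in> carrier (semigroup_ring A)"
    then obtain c where f: "f = Abs_fps (\<lambda>d. \<Sum>u\<in>?F d. c u)" by (auto simp: semigroup_ring_def)
    have "order_ge A 0 x" if "fps_nth f x \<noteq> 0" for x
    proof -
      have "?F x \<noteq> {}" using that unfolding f by (metis (no_types, lifting) fps_nth_Abs_fps sum.empty)
      then show ?thesis using ne order_ge_0_iff by blast
    qed
    then show "f \<in> order_ideal A 0" by (simp add: order_ideal_def)
  next
    fix f :: "'k fps"
    assume f: "f \<in> order_ideal A 0"
    \<comment> \<open>a chosen factorization of each exponent\<close>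
  define w where "w d = (SOME u. u \<in> ?F d)" for d
    have w: "w d \<in> ?F d" if "d \<in> semigroup_of A" for d
      unfolding w_def using ne[of d] that by (metis (no_types, lifting) all_not_in_conv someI)
    define c where "c u = (if u = w (\<Sum>a\<in>A. u a * a) then fps_nth f (\<Sum>a\<in>A. u a * a) else 0)" for u
    have "(\<Sum>u\<in>?F d. c u) = fps_nth f d" for d
    proof (cases "d \<in> semigroup_of A")
      case True
      have "(\<Sum>u\<in>?F d. c u) = (\<Sum>u\<in>?F d. if u = w d then fps_nth f d else 0)"
        by (rule sum.cong) (auto simp: c_def)
      also have "\<dots> = fps_nth f d" using w[OF True] fin[of d] by simp
      finally show ?thesis .
    next
      case False
      then have "?F d = {}" "fps_nth f d = 0"
        using ne[of d] f by (auto simp: order_ideal_def order_ge_0_iff)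
      then show ?thesis by (simp only: sum.empty)
    qed
    then have "f = Abs_fps (\<lambda>d. \<Sum>u\<in>?F d. c u)" by (simp add: fps_eq_iff)
    then show "f \<in> carrier (semigroup_ring A)" by (auto simp: semigroup_ring_def)
  qed
qed

lemma semigroup_ring_simps:
  "mult (semigroup_ring A) = (*)" "one (semigroup_ring A) = 1"
  "zero (semigroup_ring A) = 0" "add (semigroup_ring A) = (+)"
  by (simp_all add: semigroup_ring_def)

lemma order_ideal_0: "0 \<in> order_ideal A n"
  by (simp add: order_ideal_def)

lemma order_ideal_add: "f \<in> order_ideal A n \<Longrightarrow> g \<in> order_ideal A n \<Longrightarrow> f + g \<in> order_ideal A n"
  by (force simp: order_ideal_def)

lemma order_ideal_uminus: "f \<in> order_ideal A n \<Longrightarrow> - f \<in> order_ideal A n"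
  by (auto simp: order_ideal_def)

lemma order_ideal_mono: "m \<le> n \<Longrightarrow> f \<in> order_ideal A n \<Longrightarrow> f \<in> order_ideal A m"
  unfolding order_ideal_def using order_ge_mono by blast

lemma order_ideal_mult:
  assumes "f \<in> order_ideal A m" "g \<in> order_ideal A n"
  shows "f * g \<in> order_ideal A (m + n)"
  unfolding order_ideal_def
proof safe
  fix x assume "fps_nth (f * g) x \<noteq> 0"
  then obtain i where i: "i \<le> x" "fps_nth f i \<noteq> 0" "fps_nth g (x - i) \<noteq> 0"
    unfolding fps_mult_nth by (metis (no_types, lifting) atLeastAtMost_iff mult_eq_0_iff sum.neutral)
  then have "order_ge A (m + n) (i + (x - i))"
    using assms by (intro order_ge_add) (auto simp: order_ideal_def)
  with i(1) show "order_ge A (m + n) x" by simp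
qed

lemma order_ideal_const: "fps_const c \<in> order_ideal A 0"
  by (auto simp: order_ideal_def order_ge_zero)

lemma order_ideal_monomial: "order_ge A n x \<Longrightarrow> fps_const c * fps_X ^ x \<in> order_ideal A n"
  by (auto simp: order_ideal_def fps_X_power_nth)

lemma semigroup_ring_cring:
  assumes "finite A" "0 \<notin> A"
  shows "cring (semigroup_ring A :: 'k::field fps ring)"
proof -
  let ?R = "semigroup_ring A :: 'k fps ring"
  note [simp] = carrier_semigroup_ring[OF assms] semigroup_ring_simps
  have one: "1 \<in> (order_ideal A 0 :: 'k fps set)" using order_ideal_const[of 1 A] by simp
  have times: "f * g \<in> order_ideal A 0" if "f \<in> order_ideal A 0" "g \<in> order_ideal A 0" for f g :: "'k fps"
    using order_ideal_mult[OF that] by simp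
  show ?thesis
  proof (rule cringI)
    show "abelian_group ?R"
    proof (rule abelian_groupI)
      fix x assume "x \<in> carrier ?R"
      then show "\<exists>y\<in>carrier ?R. y \<oplus>\<^bsub>?R\<^esub> x = \<zero>\<^bsub>?R\<^esub>"
        by (intro bexI[of _ "- x"]) (auto simp: order_ideal_uminus)
    qed (auto simp: order_ideal_add order_ideal_0)
    show "Group.comm_monoid ?R"
      by (rule comm_monoidI) (auto simp: one times)
  qed (auto simp: distrib_right)
qed

lemma order_ideal_ideal:
  assumes "finite A" "0 \<notin> A"
  shows "ideal (order_ideal A n) (semigroup_ring A :: 'k::field fps ring)"
proof -
  let ?R = "semigroup_ring A :: 'k fps ring"
  interpret cring ?R by (rule semigroup_ring_cring[OF assms])
  note [simp] = carrier_semigroup_ring[OF assms] semigroup_ring_simps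
  have times: "f * g \<in> order_ideal A n" if "f \<in> order_ideal A 0" "g \<in> order_ideal A n" for f g :: "'k fps"
    using order_ideal_mult[OF that] by simp
  have times': "g * f \<in> order_ideal A n" if "f \<in> order_ideal A 0" "g \<in> order_ideal A n" for f g :: "'k fps"
    using times[OF that] by (simp add: mult.commute)
  have sub: "subgroup (order_ideal A n) (add_monoid ?R)"
  proof (rule group.subgroupI)
    show "Group.group (add_monoid ?R)" by (rule a_group)
    fix f assume f: "f \<in> (order_ideal A n :: 'k fps set)"
    then have "f \<in> carrier ?R" using order_ideal_mono by auto
    then have "\<ominus>\<^bsub>?R\<^esub> f = - f"
      by (intro sum_zero_eq_neg[symmetric]) (auto simp: order_ideal_uminus)
    then show "inv\<^bsub>add_monoid ?R\<^esub> f \<in> order_ideal A n"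
      using f by (simp add: a_inv_def order_ideal_uminus)
  qed (use order_ideal_0 in \<open>auto intro: order_ideal_mono order_ideal_add\<close>)
  show ?thesis
    by (rule idealI[OF ring_axioms sub]) (simp_all add: times times')
qed

text \<open>
  Splitting off one generator from every exponent in the support: the exponents are distributed
  among the generators \<open>a\<close>, each to one for which \<open>x - a\<close> still has order at least \<open>n\<close>.  This is what
  makes the order filtration coincide with the powers of the maximal ideal, infinite supports
  included.
\<close>
lemma order_ideal_Suc_decompose:
  fixes f :: "'k::field fps"
  assumes "finite A" "f \<in> order_ideal A (Suc n)"
  obtains g where "\<And>a. a \<in> A \<Longrightarrow> g a \<in> order_ideal A n" "f = (\<Sum>a\<in>A. fps_X ^ a * g a)"
proof -
  define P where "P x a \<longleftrightarrow> a \<in> A \<and> a \<le> x \<and> order_ge A n (x - a)" for x a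
  \<comment> \<open>the generator to which the exponent \<open>x\<close> is assigned\<close>
  define h where "h x = (SOME a. P x a)" for x
  have h: "P x (h x)" if x: "order_ge A (Suc n) x" for x
  proof -
    obtain a y where "a \<in> A" "x = a + y" "order_ge A n y" using order_ge_SucE[OF assms(1) x] .
    then have "P x a" by (simp add: P_def)
    then show ?thesis unfolding h_def by (rule someI)
  qed
  define g where "g a = Abs_fps (\<lambda>y. if h (a + y) = a then fps_nth f (a + y) else 0)" for a
  have fz: "fps_nth f x = 0" if "\<not> order_ge A (Suc n) x" for x
    using assms(2) that by (auto simp: order_ideal_def)
  have 1: "g a \<in> order_ideal A n" if "a \<in> A" for a
    unfolding order_ideal_def
  proof safe
    fix y assume "fps_nth (g a) y \<noteq> 0"
    then have "h (a + y) = a" "fps_nth f (a + y) \<noteq> 0" by (auto simp: g_def split: if_splits)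
    with fz[of "a + y"] h[of "a + y"] show "order_ge A n y" by (auto simp: P_def)
  qed
  have 2: "f = (\<Sum>a\<in>A. fps_X ^ a * g a)"
  proof (rule fps_ext)
    fix x
    have "fps_nth (\<Sum>a\<in>A. fps_X ^ a * g a) x
        = (\<Sum>a\<in>A. if a \<le> x \<and> h x = a then fps_nth f x else 0)"
      by (auto simp: fps_sum_nth fps_X_power_mult_nth g_def intro!: sum.cong)
    also have "\<dots> = fps_nth f x"
    proof (cases "order_ge A (Suc n) x")
      case True
      have "(\<Sum>a\<in>A. if a \<le> x \<and> h x = a then fps_nth f x else 0)
        = (\<Sum>a\<in>A. if a = h x then fps_nth f x else 0)"
        using h[OF True] by (intro sum.cong) (auto simp: P_def)
      also have "\<dots> = fps_nth f x" using h[OF True] assms(1) by (simp add: P_def)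
      finally show ?thesis .
    qed (simp add: fz cong: if_cong)
    finally show "fps_nth f x = fps_nth (\<Sum>a\<in>A. fps_X ^ a * g a) x" by simp
  qed
  from that[of g, OF 1 2] show ?thesis .
qed

lemma semigroup_max_ideal_eq:
  assumes "finite A" "0 \<notin> A"
  shows "semigroup_max_ideal A = (order_ideal A (Suc 0) :: 'k::field fps set)"
proof
  let ?R = "semigroup_ring A :: 'k fps ring"
  interpret cring ?R by (rule semigroup_ring_cring[OF assms])
  note [simp] = carrier_semigroup_ring[OF assms] semigroup_ring_simps
  let ?G = "(\<lambda>a. fps_X ^ a) ` A :: 'k fps set"
  have G: "?G \<subseteq> order_ideal A (Suc 0)"
    using order_ideal_monomial[of A "Suc 0" _ 1] order_ge_generator[OF assms(1)] by auto
  then have "?G \<subseteq> carrier ?R" using order_ideal_mono[of 0 "Suc 0"] by auto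
  note I = genideal_ideal[OF this]
  show "semigroup_max_ideal A \<subseteq> (order_ideal A (Suc 0) :: 'k fps set)"
    unfolding semigroup_max_ideal_def
    by (rule genideal_minimal[OF order_ideal_ideal[OF assms] G])
  show "order_ideal A (Suc 0) \<subseteq> (semigroup_max_ideal A :: 'k fps set)"
  proof
    fix f :: "'k fps" assume "f \<in> order_ideal A (Suc 0)"
    then obtain g where g: "\<And>a. a \<in> A \<Longrightarrow> g a \<in> order_ideal A 0" "f = (\<Sum>a\<in>A. fps_X ^ a * g a)"
      using order_ideal_Suc_decompose[OF assms(1), of f 0] by auto
    interpret I: ideal "Idl\<^bsub>?R\<^esub> ?G" ?R by (rule I)
    have *: "fps_X ^ a * g a \<in> Idl\<^bsub>?R\<^esub> ?G" if "a \<in> A" for a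
    proof -
      have "fps_X ^ a \<in> Idl\<^bsub>?R\<^esub> ?G" using genideal_self[OF \<open>?G \<subseteq> carrier ?R\<close>] that by auto
      from I.I_r_closed[OF this, of "g a"] show ?thesis using g(1)[OF that] by simp
    qed
    have "finite B \<Longrightarrow> B \<subseteq> A \<Longrightarrow> (\<Sum>a\<in>B. fps_X ^ a * g a) \<in> Idl\<^bsub>?R\<^esub> ?G" for B
    proof (induction B rule: finite_induct)
      case empty
      then show ?case using I.zero_closed by simp
    next
      case (insert a B)
      then show ?case using I.a_closed[OF *[of a], of "\<Sum>a\<in>B. fps_X ^ a * g a"] by simp
    qed
    from this[OF assms(1) order_refl] show "f \<in> semigroup_max_ideal A"
      unfolding semigroup_max_ideal_def g(2) .
  qed
qed

lemma ideal_pow_semigroup_max_ideal: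
  assumes "finite A" "0 \<notin> A"
  shows "ideal_pow (semigroup_ring A) (semigroup_max_ideal A) n = (order_ideal A n :: 'k::field fps set)"
proof (induction n)
  case 0
  then show ?case
    by (simp add: ideal_pow_def nat_pow_def ideals_set_def carrier_semigroup_ring[OF assms])
next
  case (Suc n)
  let ?R = "semigroup_ring A :: 'k fps ring"
  interpret cring ?R by (rule semigroup_ring_cring[OF assms])
  note [simp] = carrier_semigroup_ring[OF assms] semigroup_ring_simps
  note id = order_ideal_ideal[OF assms, where 'k = 'k]
  have "ideal_pow ?R (semigroup_max_ideal A) (Suc n) = order_ideal A n \<cdot>\<^bsub>?R\<^esub> order_ideal A (Suc 0)"
    using Suc.IH unfolding ideal_pow_def semigroup_max_ideal_eq[OF assms]
    by (simp add: nat_pow_def ideals_set_def)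
  also have "\<dots> = order_ideal A (Suc n)"
  proof
    show "order_ideal A n \<cdot>\<^bsub>?R\<^esub> order_ideal A (Suc 0) \<subseteq> order_ideal A (Suc n)"
    proof
      fix f assume "f \<in> order_ideal A n \<cdot>\<^bsub>?R\<^esub> order_ideal A (Suc 0)"
      then show "f \<in> order_ideal A (Suc n)"
      proof induction
        case (prod i j)
        then show ?case using order_ideal_mult[of i A n j "Suc 0"] by simp
      qed (auto intro: order_ideal_add)
    qed
    show "order_ideal A (Suc n) \<subseteq> order_ideal A n \<cdot>\<^bsub>?R\<^esub> order_ideal A (Suc 0)"
    proof
      fix f :: "'k fps" assume "f \<in> order_ideal A (Suc n)"
      then obtain g where g: "\<And>a. a \<in> A \<Longrightarrow> g a \<in> order_ideal A n" "f = (\<Sum>a\<in>A. fps_X ^ a * g a)"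
        using order_ideal_Suc_decompose[OF assms(1), of f n] by auto
      interpret I: ideal "order_ideal A n \<cdot>\<^bsub>?R\<^esub> order_ideal A (Suc 0)" ?R
        by (rule ideal_prod_is_ideal[OF id id])
      have *: "fps_X ^ a * g a \<in> order_ideal A n \<cdot>\<^bsub>?R\<^esub> order_ideal A (Suc 0)" if "a \<in> A" for a
        using ideal_prod.prod[of "g a" "order_ideal A n" "fps_X ^ a" "order_ideal A (Suc 0)" ?R] g(1)[OF that]
          order_ideal_monomial[OF order_ge_generator[OF assms(1) that], of 1]
        by (simp add: mult.commute)
      have "finite B \<Longrightarrow> B \<subseteq> A \<Longrightarrow> (\<Sum>a\<in>B. fps_X ^ a * g a) \<in> order_ideal A n \<cdot>\<^bsub>?R\<^esub> order_ideal A (Suc 0)" for B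
      proof (induction B rule: finite_induct)
        case empty
        then show ?case using I.zero_closed by simp
      next
        case (insert a B)
        then show ?case using I.a_closed[OF *[of a], of "\<Sum>a\<in>B. fps_X ^ a * g a"] by simp
      qed
      from this[OF assms(1) order_refl] show "f \<in> order_ideal A n \<cdot>\<^bsub>?R\<^esub> order_ideal A (Suc 0)"
        unfolding g(2) .
    qed
  qed
  finally show ?case .
qed


section \<open>Graded pieces of the tangent cone\<close>

text \<open>
  The general form of a graded piece: if \<open>M I \<subseteq> J \<subseteq> I\<close>, then \<open>R / M\<close> acts on \<open>I / J\<close>.  The product of
  cosets in the definition of the scalar action does not depend on representatives because a change
  by an element of \<open>M\<close> is absorbed by \<open>J\<close>.
\<close>
lemma quotient_module:
  fixes R :: "('a, 'b) ring_scheme" (structure)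
  assumes "cring R" "ideal M R" "ideal I R" "ideal J R" "J \<subseteq> I"
    and MI: "\<And>r x. r \<in> M \<Longrightarrow> x \<in> I \<Longrightarrow> r \<otimes> x \<in> J"
  defines "V \<equiv> \<lparr>carrier = (\<lambda>x. J +> x) ` I, mult = rcoset_mult R J, one = J +> \<one>, zero = J,
                 add = set_add R, smult = rcoset_mult R J\<rparr>"
  shows quotient_module_smult:
      "\<And>r x. r \<in> carrier R \<Longrightarrow> x \<in> I \<Longrightarrow> (M +> r) \<odot>\<^bsub>V\<^esub> (J +> x) = J +> (r \<otimes> x)"
    and "module (R Quot M) V"
proof -
  interpret cring R by fact
  interpret M: ideal M R by fact
  interpret I: ideal I R by fact
  interpret J: ideal J R by fact
  note [simp] = I.Icarr J.Icarr M.Icarr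
  show sm: "(M +> r) \<odot>\<^bsub>V\<^esub> (J +> x) = J +> (r \<otimes> x)" if r: "r \<in> carrier R" and x: "x \<in> I" for r x
  proof -
    have *: "J +> (a \<otimes> b) = J +> (r \<otimes> x)" if ab: "a \<in> M +> r" "b \<in> J +> x" for a b
    proof -
      obtain m where m: "m \<in> M" "a = m \<oplus> r" using ab(1) by (auto simp: a_r_coset_def')
      obtain j where j: "j \<in> J" "b = j \<oplus> x" using ab(2) by (auto simp: a_r_coset_def')
      have "a \<otimes> b = (a \<otimes> j \<oplus> m \<otimes> x) \<oplus> r \<otimes> x"
        using r x m j by (simp add: r_distr l_distr a_assoc)
      moreover have "a \<otimes> j \<oplus> m \<otimes> x \<in> J"
        using r m j MI[OF m(1) x] J.a_closed J.I_l_closed[of j a] by simp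
      ultimately have "a \<otimes> b \<in> J +> (r \<otimes> x)" by (auto simp: a_r_coset_def')
      then show ?thesis using r x by (metis I.Icarr J.a_repr_independence' m_closed)
    qed
    have "r \<in> M +> r" "x \<in> J +> x" using r x by (simp_all add: M.a_rcos_self J.a_rcos_self)
    then have "(\<Union>a\<in>M +> r. \<Union>b\<in>J +> x. J +> a \<otimes> b) = J +> (r \<otimes> x)" using * by fast
    then show ?thesis by (simp add: V_def rcoset_mult_def)
  qed
  have add: "(J +> x) \<oplus>\<^bsub>V\<^esub> (J +> y) = J +> (x \<oplus> y)" if "x \<in> I" "y \<in> I" for x y
    using that by (simp add: V_def J.a_rcos_sum)
  have carr: "X \<in> carrier V \<longleftrightarrow> (\<exists>x\<in>I. X = J +> x)" for X by (auto simp: V_def)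
  have zero: "\<zero>\<^bsub>V\<^esub> = J +> \<zero>" by (simp add: V_def J.a_rcos_const[OF J.zero_closed])
  have Q: "X \<in> carrier (R Quot M) \<longleftrightarrow> (\<exists>r\<in>carrier R. X = M +> r)" for X
    by (auto simp: FactRing_def A_RCOSETS_def')
  have Qadd: "(M +> r) \<oplus>\<^bsub>R Quot M\<^esub> (M +> t) = M +> (r \<oplus> t)"
    if "r \<in> carrier R" "t \<in> carrier R" for r t using that by (simp add: FactRing_def M.a_rcos_sum)
  have Qmult: "(M +> r) \<otimes>\<^bsub>R Quot M\<^esub> (M +> t) = M +> (r \<otimes> t)"
    if "r \<in> carrier R" "t \<in> carrier R" for r t using that by (simp add: FactRing_def M.rcoset_mult_add)
  have Qone: "\<one>\<^bsub>R Quot M\<^esub> = M +> \<one>" by (simp add: FactRing_def)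
  have ag: "abelian_group V"
  proof (rule abelian_groupI)
    fix X Y assume "X \<in> carrier V" "Y \<in> carrier V"
    then obtain x y where xy: "x \<in> I" "y \<in> I" "X = J +> x" "Y = J +> y" using carr by auto
    then show "X \<oplus>\<^bsub>V\<^esub> Y \<in> carrier V" "X \<oplus>\<^bsub>V\<^esub> Y = Y \<oplus>\<^bsub>V\<^esub> X"
      by (auto simp: add carr a_comm)
    fix Z assume "Z \<in> carrier V"
    then obtain z where "z \<in> I" "Z = J +> z" using carr by auto
    then show "X \<oplus>\<^bsub>V\<^esub> Y \<oplus>\<^bsub>V\<^esub> Z = X \<oplus>\<^bsub>V\<^esub> (Y \<oplus>\<^bsub>V\<^esub> Z)"
      using xy by (simp add: add a_assoc)
  next
    show "\<zero>\<^bsub>V\<^esub> \<in> carrier V" by (auto simp: zero carr)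
  next
    fix X assume "X \<in> carrier V"
    then obtain x where x: "x \<in> I" "X = J +> x" using carr by auto
    then show "\<zero>\<^bsub>V\<^esub> \<oplus>\<^bsub>V\<^esub> X = X" by (simp add: zero add)
    have "\<ominus> x \<in> I" using x by simp
    then show "\<exists>Y\<in>carrier V. Y \<oplus>\<^bsub>V\<^esub> X = \<zero>\<^bsub>V\<^esub>"
      using x by (intro bexI[of _ "J +> (\<ominus> x)"]) (auto simp: add zero l_neg carr)
  qed
  show "module (R Quot M) V"
  proof (rule moduleI)
    show "cring (R Quot M)" by (rule M.quotient_is_cring) fact
    show "abelian_group V" by (rule ag)
  next
    fix a X assume "a \<in> carrier (R Quot M)" "X \<in> carrier V"
    then show "a \<odot>\<^bsub>V\<^esub> X \<in> carrier V"
      by (auto simp: Q carr sm intro: I.I_l_closed)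
  next
    fix a b X
    assume "a \<in> carrier (R Quot M)" "b \<in> carrier (R Quot M)" "X \<in> carrier V"
    then obtain r t x where rx: "r \<in> carrier R" "a = M +> r" "t \<in> carrier R" "b = M +> t"
      "x \<in> I" "X = J +> x"
      using Q carr by auto
    then show "(a \<oplus>\<^bsub>R Quot M\<^esub> b) \<odot>\<^bsub>V\<^esub> X = a \<odot>\<^bsub>V\<^esub> X \<oplus>\<^bsub>V\<^esub> b \<odot>\<^bsub>V\<^esub> X"
      by (simp add: Qadd sm add l_distr I.I_l_closed)
    from rx show "(a \<otimes>\<^bsub>R Quot M\<^esub> b) \<odot>\<^bsub>V\<^esub> X = a \<odot>\<^bsub>V\<^esub> (b \<odot>\<^bsub>V\<^esub> X)"
      by (simp add: Qmult sm m_assoc I.I_l_closed)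
  next
    fix a X Y
    assume "a \<in> carrier (R Quot M)" "X \<in> carrier V" "Y \<in> carrier V"
    then obtain r x y where "r \<in> carrier R" "a = M +> r" "x \<in> I" "X = J +> x" "y \<in> I" "Y = J +> y"
      using Q carr by auto
    then show "a \<odot>\<^bsub>V\<^esub> (X \<oplus>\<^bsub>V\<^esub> Y) = a \<odot>\<^bsub>V\<^esub> X \<oplus>\<^bsub>V\<^esub> a \<odot>\<^bsub>V\<^esub> Y"
      by (simp add: add sm r_distr I.I_l_closed)
  next
    fix X assume "X \<in> carrier V"
    then show "\<one>\<^bsub>R Quot M\<^esub> \<odot>\<^bsub>V\<^esub> X = X" by (auto simp: carr Qone sm)
  qed
qed

text \<open>
  The residue field consists of the constants: an element of order 0 in the semigroup is 0.
\<close>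
lemma order_ideal_1_coset:
  assumes "finite A" "0 \<notin> A" and f: "f \<in> (order_ideal A 0 :: 'k::field fps set)"
  shows "order_ideal A (Suc 0) +>\<^bsub>semigroup_ring A\<^esub> f
    = order_ideal A (Suc 0) +>\<^bsub>semigroup_ring A\<^esub> fps_const (fps_nth f 0)"
proof -
  let ?R = "semigroup_ring A :: 'k fps ring"
  interpret M: ideal "order_ideal A (Suc 0)" ?R by (rule order_ideal_ideal[OF assms(1,2)])
  let ?c = "fps_const (fps_nth f 0)"
  have "f - ?c \<in> order_ideal A (Suc 0)"
    unfolding order_ideal_def
  proof safe
    fix x assume x: "fps_nth (f - ?c) x \<noteq> 0"
    then have "x \<noteq> 0" "fps_nth f x \<noteq> 0" by (cases x; simp)+
    then show "order_ge A (Suc 0) x"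
      unfolding order_ge_1_iff[OF assms(1,2)] using f by (auto simp: order_ideal_def order_ge_0_iff)
  qed
  then have "f \<in> order_ideal A (Suc 0) +>\<^bsub>?R\<^esub> ?c"
    by (auto simp: a_r_coset_def' semigroup_ring_simps intro!: bexI[of _ "f - ?c"])
  then show ?thesis
    using M.a_repr_independence'[of f ?c] order_ideal_const[of "fps_nth f 0" A]
    by (simp add: carrier_semigroup_ring[OF assms(1,2)])
qed

lemma order_ideal_1_const:
  assumes "finite A" "0 \<notin> A"
  shows "fps_const c \<in> (order_ideal A (Suc 0) :: 'k::field fps set) \<longleftrightarrow> c = 0"
  using order_ge_1_iff[OF assms, of 0] by (auto simp: order_ideal_def)

lemma residue_field:
  assumes "finite A" "0 \<notin> A"
  shows "field (semigroup_ring A Quot (order_ideal A (Suc 0) :: 'k::field fps set))"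
proof -
  let ?R = "semigroup_ring A :: 'k fps ring" and ?M = "order_ideal A (Suc 0) :: 'k fps set"
  interpret cring ?R by (rule semigroup_ring_cring[OF assms])
  interpret M: ideal ?M ?R by (rule order_ideal_ideal[OF assms])
  interpret Q: cring "?R Quot ?M" by (rule M.quotient_is_cring) (rule is_cring)
  note [simp] = carrier_semigroup_ring[OF assms] semigroup_ring_simps
  have const: "\<exists>c. X = ?M +>\<^bsub>?R\<^esub> fps_const c" if "X \<in> carrier (?R Quot ?M)" for X
    using that order_ideal_1_coset[OF assms] by (auto simp: FactRing_def A_RCOSETS_def')
  have zero: "?M +>\<^bsub>?R\<^esub> fps_const c = \<zero>\<^bsub>?R Quot ?M\<^esub> \<longleftrightarrow> c = 0" for c
  proof -
    have "?M +>\<^bsub>?R\<^esub> fps_const c = ?M \<longleftrightarrow> fps_const c \<in> ?M"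
      using order_ideal_const[of c A] M.a_rcos_self[of "fps_const c"] M.a_rcos_const by auto
    then show ?thesis using order_ideal_1_const[OF assms, of c] by (simp add: FactRing_def)
  qed
  show ?thesis
  proof (rule Q.cring_fieldI2)
    show "\<zero>\<^bsub>?R Quot ?M\<^esub> \<noteq> \<one>\<^bsub>?R Quot ?M\<^esub>"
      using zero[of 1] by (auto simp: FactRing_def)
    fix X assume X: "X \<in> carrier (?R Quot ?M)" "X \<noteq> \<zero>\<^bsub>?R Quot ?M\<^esub>"
    then obtain c where c: "X = ?M +>\<^bsub>?R\<^esub> fps_const c" "c \<noteq> 0" using const zero by metis
    have "X \<otimes>\<^bsub>?R Quot ?M\<^esub> (?M +>\<^bsub>?R\<^esub> fps_const (1 / c)) = \<one>\<^bsub>?R Quot ?M\<^esub>"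
      using c by (simp add: FactRing_def M.rcoset_mult_add order_ideal_const)
    moreover have "?M +>\<^bsub>?R\<^esub> fps_const (1 / c) \<in> carrier (?R Quot ?M)"
      using order_ideal_const[of "1/c" A] by (auto simp: FactRing_def A_RCOSETS_def')
    ultimately show "\<exists>Y\<in>carrier (?R Quot ?M). X \<otimes>\<^bsub>?R Quot ?M\<^esub> Y = \<one>\<^bsub>?R Quot ?M\<^esub>" by blast
  qed
qed

text \<open>
  The cosets of \<open>t\<^sup>x\<close>, with \<open>x\<close> of order exactly \<open>n\<close>, are a basis of the \<open>n\<close>-th graded piece: modulo
  the next power of the maximal ideal a series of order at least \<open>n\<close> only retains its coefficients
  at these \<open>x\<close>, and a combination of these monomials lies in the next power only if it vanishes.
\<close>
theorem hilbert_function_semigroup_ring: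
  assumes A: "finite A" "0 \<notin> A"
  shows "hilbert_function (semigroup_ring A :: 'k::field fps ring) (semigroup_max_ideal A) n
    = card {x. order_ge A n x \<and> \<not> order_ge A (Suc n) x}"
proof -
  let ?R = "semigroup_ring A :: 'k fps ring" and ?M = "order_ideal A (Suc 0) :: 'k fps set"
  let ?I = "order_ideal A n :: 'k fps set" and ?J = "order_ideal A (Suc n) :: 'k fps set"
  let ?B = "{x. order_ge A n x \<and> \<not> order_ge A (Suc n) x}"
  define V where "V = graded_piece ?R ?M n"
  interpret cring ?R by (rule semigroup_ring_cring[OF A])
  interpret M: ideal ?M ?R by (rule order_ideal_ideal[OF A])
  interpret I: ideal ?I ?R by (rule order_ideal_ideal[OF A])
  interpret J: ideal ?J ?R by (rule order_ideal_ideal[OF A])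
  note [simp] = carrier_semigroup_ring[OF A] semigroup_ring_simps
  have pow: "ideal_pow ?R ?M k = order_ideal A k" for k
    using ideal_pow_semigroup_max_ideal[OF A, of k, where 'k = 'k]
    by (simp add: semigroup_max_ideal_eq[OF A])
  have V: "V = \<lparr>carrier = (\<lambda>x. ?J +>\<^bsub>?R\<^esub> x) ` ?I, mult = rcoset_mult ?R ?J,
      one = ?J +>\<^bsub>?R\<^esub> \<one>\<^bsub>?R\<^esub>, zero = ?J, add = set_add ?R, smult = rcoset_mult ?R ?J\<rparr>"
    unfolding V_def graded_piece_def pow Let_def ..
  have JI: "?J \<subseteq> ?I" using order_ideal_mono[of n "Suc n"] by auto
  have MI: "r \<otimes>\<^bsub>?R\<^esub> x \<in> ?J" if "r \<in> ?M" "x \<in> ?I" for r x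
    using order_ideal_mult[OF that] by simp
  note QM = quotient_module[OF is_cring M.is_ideal I.is_ideal J.is_ideal JI MI, folded V]
  interpret V: vectorspace "?R Quot ?M" V
    by (rule vectorspace.intro[OF QM(2) residue_field[OF A]])
  define e where "e x = ?J +>\<^bsub>?R\<^esub> fps_X ^ x" for x
  have XI: "fps_X ^ x \<in> ?I" if "x \<in> ?B" for x
    using order_ideal_monomial[of A n x 1] that by simp
  have e_carr: "e x \<in> carrier V" if "x \<in> ?B" for x
    using XI[OF that] by (simp add: e_def V)
  have coset_eq_iff: "?J +>\<^bsub>?R\<^esub> f = ?J +>\<^bsub>?R\<^esub> g \<longleftrightarrow> f - g \<in> ?J" if "f \<in> ?I" "g \<in> ?I" for f g
  proof -
    have fg: "f \<in> carrier ?R" "g \<in> carrier ?R" using that I.Icarr by blast+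
    have "?J +>\<^bsub>?R\<^esub> f = ?J +>\<^bsub>?R\<^esub> g \<longleftrightarrow> f \<in> ?J +>\<^bsub>?R\<^esub> g"
      using J.a_repr_independence'[of f g] J.a_rcos_self[of f] fg by auto
    also have "\<dots> \<longleftrightarrow> f - g \<in> ?J"
      by (auto simp: a_r_coset_def' intro!: bexI[of _ "f - g"])
    finally show ?thesis .
  qed
  have lin: "(\<Oplus>\<^bsub>V\<^esub>x\<in>X. (?M +>\<^bsub>?R\<^esub> fps_const (c x)) \<odot>\<^bsub>V\<^esub> e x)
      = ?J +>\<^bsub>?R\<^esub> (\<Sum>x\<in>X. fps_const (c x) * fps_X ^ x) \<and> (\<Sum>x\<in>X. fps_const (c x) * fps_X ^ x) \<in> ?I"
    if "finite X" "X \<subseteq> ?B" for X c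
    using that
  proof (induction X rule: finite_induct)
    case empty
    have "\<zero>\<^bsub>V\<^esub> = ?J" by (simp add: V)
    then show ?case using J.a_rcos_const[OF order_ideal_0] order_ideal_0[of A n] by simp
  next
    case (insert x X)
    let ?f = "\<lambda>x. fps_const (c x) * fps_X ^ x"
    have tm: "(?M +>\<^bsub>?R\<^esub> fps_const (c y)) \<odot>\<^bsub>V\<^esub> e y = ?J +>\<^bsub>?R\<^esub> ?f y" "?f y \<in> ?I" if "y \<in> ?B" for y
      using QM(1)[of "fps_const (c y)" "fps_X ^ y"] XI[OF that] order_ideal_const[of "c y" A]
        order_ideal_monomial[of A n y "c y"] that
      by (simp_all add: e_def)
    have tc: "(?M +>\<^bsub>?R\<^esub> fps_const (c y)) \<odot>\<^bsub>V\<^esub> e y \<in> carrier V" if "y \<in> ?B" for y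
      using tm[OF that] by (simp add: V)
    have "(\<Oplus>\<^bsub>V\<^esub>y\<in>insert x X. (?M +>\<^bsub>?R\<^esub> fps_const (c y)) \<odot>\<^bsub>V\<^esub> e y)
        = (?M +>\<^bsub>?R\<^esub> fps_const (c x)) \<odot>\<^bsub>V\<^esub> e x \<oplus>\<^bsub>V\<^esub>
          (\<Oplus>\<^bsub>V\<^esub>y\<in>X. (?M +>\<^bsub>?R\<^esub> fps_const (c y)) \<odot>\<^bsub>V\<^esub> e y)"
    proof (rule V.M.finsum_insert)
      show "finite X" "x \<notin> X" by (fact insert.hyps)+
      show "(\<lambda>y. (?M +>\<^bsub>?R\<^esub> fps_const (c y)) \<odot>\<^bsub>V\<^esub> e y) \<in> X \<rightarrow> carrier V"
        by (intro Pi_I tc) (use insert.prems in blast)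
      show "(?M +>\<^bsub>?R\<^esub> fps_const (c x)) \<odot>\<^bsub>V\<^esub> e x \<in> carrier V"
        by (intro tc) (use insert.prems in blast)
    qed
    also have "\<dots> = (?J +>\<^bsub>?R\<^esub> ?f x) \<oplus>\<^bsub>V\<^esub> (?J +>\<^bsub>?R\<^esub> (\<Sum>x\<in>X. ?f x))"
      using insert tm by simp
    also have "\<dots> = ?J +>\<^bsub>?R\<^esub> (?f x + (\<Sum>x\<in>X. ?f x))"
      using J.a_rcos_sum[of "?f x" "\<Sum>x\<in>X. ?f x"] insert tm I.Icarr by (simp add: V)
    finally show ?case using insert tm by (auto intro: order_ideal_add)
  qed
  have nth: "fps_nth (\<Sum>x\<in>X. fps_const (c x) * fps_X ^ x) y = (if y \<in> X then c y else 0)"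
    if "finite X" for X c y
    using that by (simp add: fps_sum_nth fps_X_power_nth if_distrib cong: if_cong)
  have notJ: "f \<notin> ?J" if "fps_nth f x \<noteq> 0" "x \<in> ?B" for f x
    using that by (auto simp: order_ideal_def)
  have inj: "inj_on e ?B"
  proof (rule inj_onI, rule ccontr)
    fix x y assume *: "x \<in> ?B" "y \<in> ?B" "e x = e y" "x \<noteq> y"
    then have "fps_X ^ x - fps_X ^ y \<in> ?J" using coset_eq_iff[of "fps_X ^ x" "fps_X ^ y"] XI
      by (simp add: e_def)
    with notJ[of "fps_X ^ x - fps_X ^ y" x] * show False by (auto simp: fps_X_power_nth)
  qed
  have fin: "finite ?B" by (rule finite_order_eq[OF A(1)])
  have scalar: "\<exists>c. X = ?M +>\<^bsub>?R\<^esub> fps_const c" if "X \<in> carrier (?R Quot ?M)" for X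
    using that order_ideal_1_coset[OF A] by (auto simp: FactRing_def A_RCOSETS_def')
  have const: "?M +>\<^bsub>?R\<^esub> fps_const c \<in> carrier (?R Quot ?M)" for c
    using order_ideal_const[of c A] by (auto simp: FactRing_def A_RCOSETS_def')
  have lincomb: "V.lincomb a (e ` X) = (\<Oplus>\<^bsub>V\<^esub>x\<in>X. a (e x) \<odot>\<^bsub>V\<^esub> e x)"
    if "X \<subseteq> ?B" "a \<in> e ` X \<rightarrow> carrier (?R Quot ?M)" for X a
    unfolding V.lincomb_def
    by (rule V.M.finsum_reindex) (use that e_carr inj_on_subset[OF inj that(1)] in auto)
  have "V.lin_indpt (e ` ?B)"
    unfolding V.lin_dep_def
  proof clarify
    fix C a v
    assume C: "finite C" "C \<subseteq> e ` ?B" and a: "a \<in> C \<rightarrow> carrier (?R Quot ?M)"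
      and 0: "V.lincomb a C = \<zero>\<^bsub>V\<^esub>" and v: "v \<in> C" "a v \<noteq> \<zero>\<^bsub>?R Quot ?M\<^esub>"
    obtain X where X: "X \<subseteq> ?B" "C = e ` X" using C(2) by (auto simp: subset_image_iff)
    have finX: "finite X" using finite_subset[OF X(1) fin] .
    obtain c where c: "\<And>x. x \<in> X \<Longrightarrow> a (e x) = ?M +>\<^bsub>?R\<^esub> fps_const (c x)"
    proof -
      have "\<forall>x\<in>X. \<exists>c. a (e x) = ?M +>\<^bsub>?R\<^esub> fps_const c" using scalar a X(2) by auto
      then show ?thesis using that by metis
    qed
    have "(\<Oplus>\<^bsub>V\<^esub>x\<in>X. a (e x) \<odot>\<^bsub>V\<^esub> e x) = (\<Oplus>\<^bsub>V\<^esub>x\<in>X. (?M +>\<^bsub>?R\<^esub> fps_const (c x)) \<odot>\<^bsub>V\<^esub> e x)"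
    proof (rule V.M.finsum_cong')
      show "(\<lambda>x. (?M +>\<^bsub>?R\<^esub> fps_const (c x)) \<odot>\<^bsub>V\<^esub> e x) \<in> X \<rightarrow> carrier V"
        by (intro Pi_I V.smult_closed const e_carr) (use X(1) in blast)
    qed (use c in auto)
    then have "?J +>\<^bsub>?R\<^esub> (\<Sum>x\<in>X. fps_const (c x) * fps_X ^ x) = ?J"
      using lin[OF finX X(1), of c] 0 lincomb[OF X(1), of a] a X(2) by (simp add: V)
    then have J: "(\<Sum>x\<in>X. fps_const (c x) * fps_X ^ x) \<in> ?J"
      using J.a_rcos_self[of "\<Sum>x\<in>X. fps_const (c x) * fps_X ^ x"] lin[OF finX X(1), of c] I.Icarr by auto
    obtain x where x: "x \<in> X" "v = e x" using v(1) X(2) by auto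
    have "c x \<noteq> 0"
    proof
      assume "c x = 0"
      then have "a v = ?M" using c[OF x(1)] x(2) M.a_rcos_const[OF M.zero_closed] by simp
      with v(2) show False by (simp add: FactRing_def)
    qed
    then show False
      using notJ[of "\<Sum>x\<in>X. fps_const (c x) * fps_X ^ x" x] nth[OF finX, of c x] x X(1) J by auto
  qed
  moreover have "V.span (e ` ?B) = carrier V"
  proof
    show "V.span (e ` ?B) \<subseteq> carrier V" using e_carr by (intro V.span_is_subset2) auto
    show "carrier V \<subseteq> V.span (e ` ?B)"
    proof
      fix F assume "F \<in> carrier V"
      then obtain f where f: "f \<in> ?I" "F = ?J +>\<^bsub>?R\<^esub> f" by (auto simp: V)
      define a where "a v = ?M +>\<^bsub>?R\<^esub> fps_const (fps_nth f (inv_into ?B e v))" for v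
      have a: "a \<in> e ` ?B \<rightarrow> carrier (?R Quot ?M)"
        unfolding a_def by (intro Pi_I const)
      let ?s = "\<Sum>x\<in>?B. fps_const (fps_nth f x) * fps_X ^ x"
      have "V.lincomb a (e ` ?B) = (\<Oplus>\<^bsub>V\<^esub>x\<in>?B. a (e x) \<odot>\<^bsub>V\<^esub> e x)"
        by (rule lincomb) (use a in auto)
      also have "\<dots> = (\<Oplus>\<^bsub>V\<^esub>x\<in>?B. (?M +>\<^bsub>?R\<^esub> fps_const (fps_nth f x)) \<odot>\<^bsub>V\<^esub> e x)"
      proof (rule V.M.finsum_cong')
        show "(\<lambda>x. (?M +>\<^bsub>?R\<^esub> fps_const (fps_nth f x)) \<odot>\<^bsub>V\<^esub> e x) \<in> ?B \<rightarrow> carrier V"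
          by (intro Pi_I V.smult_closed const e_carr)
      qed (use inj in \<open>auto simp: a_def inv_into_f_f\<close>)
      also have "\<dots> = ?J +>\<^bsub>?R\<^esub> ?s" using lin[OF fin order_refl] by blast
      also have "\<dots> = F"
      proof -
        have "?s - f \<in> ?J"
          unfolding order_ideal_def using nth[OF fin, of "fps_nth f"] f(1)
          by (auto simp: order_ideal_def split: if_splits)
        then show ?thesis using coset_eq_iff[of ?s f] lin[OF fin order_refl, of "fps_nth f"] f by simp
      qed
      finally show "F \<in> V.span (e ` ?B)"
        unfolding V.span_def using a fin by blast
    qed
  qed
  ultimately have "V.basis (e ` ?B)"
    unfolding V.basis_def using e_carr by auto
  then have "V.dim = card (e ` ?B)" using fin by (intro V.dim_basis) auto
  then show ?thesis
    using card_image[OF inj] by (simp add: hilbert_function_def V_def semigroup_max_ideal_eq[OF A])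
qed

section \<open>Generating functions that count by degree\<close>

definition count_gf :: "'a set \<Rightarrow> ('a \<Rightarrow> nat) \<Rightarrow> rat fps" where
  "count_gf X f = Abs_fps (\<lambda>n. of_nat (card {x \<in> X. f x = n}))"

lemma count_gf_UN:
  assumes "finite I" "\<And>i j. i \<in> I \<Longrightarrow> j \<in> I \<Longrightarrow> i \<noteq> j \<Longrightarrow> X i \<inter> X j = {}"
    and "\<And>i n. i \<in> I \<Longrightarrow> finite {x \<in> X i. f x = n}"
  shows "count_gf (\<Union>i\<in>I. X i) f = (\<Sum>i\<in>I. count_gf (X i) f)"
proof (rule fps_ext)
  fix n
  have "{x \<in> (\<Union>i\<in>I. X i). f x = n} = (\<Union>i\<in>I. {x \<in> X i. f x = n})" by auto
  also have "card (\<Union>i\<in>I. {x \<in> X i. f x = n}) = (\<Sum>i\<in>I. card {x \<in> X i. f x = n})"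
  proof (rule card_UN_disjoint)
    show "\<forall>i\<in>I. \<forall>j\<in>I. i \<noteq> j \<longrightarrow> {x \<in> X i. f x = n} \<inter> {x \<in> X j. f x = n} = {}"
      using assms(2) by blast
  qed (use assms(1,3) in simp_all)
  finally show "fps_nth (count_gf (\<Union>i\<in>I. X i) f) n = fps_nth (\<Sum>i\<in>I. count_gf (X i) f) n"
    unfolding count_gf_def fps_sum_nth fps_nth_Abs_fps by (simp only: of_nat_sum)
qed

lemma count_gf_times:
  assumes "\<And>n. finite {x \<in> X. f x = n}" "\<And>n. finite {y \<in> Y. g y = n}"
  shows "count_gf (X \<times> Y) (\<lambda>(x, y). f x + g y) = count_gf X f * count_gf Y g"
proof (rule fps_ext)
  fix n
  have "{z \<in> X \<times> Y. (case z of (x, y) \<Rightarrow> f x + g y) = n}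
      = (\<Union>i\<in>{0..n}. {x \<in> X. f x = i} \<times> {y \<in> Y. g y = n - i})" by auto
  then have "card {z \<in> X \<times> Y. (case z of (x, y) \<Rightarrow> f x + g y) = n}
      = (\<Sum>i=0..n. card ({x \<in> X. f x = i} \<times> {y \<in> Y. g y = n - i}))"
    by (simp only:) (rule card_UN_disjoint, use assms in auto)
  then show "fps_nth (count_gf (X \<times> Y) (\<lambda>(x, y). f x + g y)) n = fps_nth (count_gf X f * count_gf Y g) n"
    by (simp add: count_gf_def fps_mult_nth card_cartesian_product)
qed

lemma count_gf_image:
  assumes "inj_on h X"
  shows "count_gf (h ` X) f = count_gf X (\<lambda>x. f (h x))"
proof -
  have "card {y \<in> h ` X. f y = n} = card {x \<in> X. f (h x) = n}" for n
  proof -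
    have "{y \<in> h ` X. f y = n} = h ` {x \<in> X. f (h x) = n}" by auto
    then show ?thesis using card_image[OF inj_on_subset[OF assms]] by (metis (no_types, lifting) mem_Collect_eq subsetI)
  qed
  then show ?thesis by (simp add: count_gf_def)
qed

lemma count_gf_shift: "count_gf X (\<lambda>x. k + f x) = fps_X ^ k * count_gf X f"
proof (rule fps_ext)
  fix n
  have "{x \<in> X. k + f x = n} = (if n < k then {} else {x \<in> X. f x = n - k})" by auto
  then show "fps_nth (count_gf X (\<lambda>x. k + f x)) n = fps_nth (fps_X ^ k * count_gf X f) n"
    by (simp add: count_gf_def fps_X_power_mult_nth)
qed

lemma count_gf_lessThan: "(1 - fps_X) * count_gf {..<m} (\<lambda>x. x) = 1 - fps_X ^ m"
proof (rule fps_ext)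
  fix n
  have "{x \<in> {..<m}. x = k} = (if k < m then {k} else {})" for k by auto
  then have c: "fps_nth (count_gf {..<m} (\<lambda>x. x)) k = (if k < m then 1 else 0)" for k
    by (simp add: count_gf_def)
  show "fps_nth ((1 - fps_X) * count_gf {..<m} (\<lambda>x. x)) n = fps_nth (1 - fps_X ^ m) n"
    by (cases n) (auto simp: left_diff_distrib c fps_X_power_nth)
qed

lemma count_gf_UNIV: "(1 - fps_X) * count_gf UNIV (\<lambda>x. x) = 1"
proof (rule fps_ext)
  fix n
  have c: "fps_nth (count_gf UNIV (\<lambda>x. x)) k = 1" for k
    by (simp add: count_gf_def)
  show "fps_nth ((1 - fps_X) * count_gf UNIV (\<lambda>x. x)) n = fps_nth 1 n"
    by (cases n) (auto simp: left_diff_distrib c)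
qed

lemma sum_atMost_backwards: "(\<Sum>w\<le>n. f w) = f 0 + (\<Sum>i<n. f (n - i))" for f :: "nat \<Rightarrow> 'a::comm_monoid_add"
proof -
  have "(\<Sum>w\<le>n. f w) = f 0 + (\<Sum>i<n. f (Suc i))"
    by (simp flip: lessThan_Suc_atMost add: sum.lessThan_Suc_shift del: sum.lessThan_Suc)
  also have "(\<Sum>i<n. f (Suc i)) = (\<Sum>i<n. f (Suc (n - Suc i)))"
    by (rule sum.nat_diff_reindex[symmetric])
  also have "\<dots> = (\<Sum>i<n. f (n - i))" by (rule sum.cong) (auto simp: Suc_diff_Suc)
  finally show ?thesis .
qed

lemma mono_upto:
  fixes s :: "nat \<Rightarrow> nat"
  assumes "\<And>i. Suc i \<le> d \<Longrightarrow> s i \<le> s (Suc i)" "i \<le> k" "k \<le> d"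
  shows "s i \<le> s k"
  using assms(2,3)
proof (induction k rule: dec_induct)
  case (step k)
  then show ?case using assms(1)[of k] by simp
qed simp

text \<open>
  For a nondecreasing \<open>s\<close> starting at 0 the intervals \<open>[s (i-1), s i)\<close> partition \<open>[0, s d)\<close>, and \<open>i\<close>
  is the first index with \<open>j < s i\<close> exactly for \<open>j\<close> in the \<open>i\<close>-th interval.
\<close>
lemma sum_first_exceeding:
  fixes s :: "nat \<Rightarrow> nat" and f :: "nat \<Rightarrow> nat \<Rightarrow> 'a::comm_monoid_add"
  assumes "s 0 = 0" "\<And>i. Suc i \<le> d \<Longrightarrow> s i \<le> s (Suc i)"
  shows "(\<Sum>j<s d. f j (LEAST i. j < s i)) = (\<Sum>i=1..d. \<Sum>j=s (i - 1)..<s i. f j i)"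
  using assms
proof (induction d)
  case (Suc d)
  have mono: "i \<le> d \<Longrightarrow> s i \<le> s d" for i
    using mono_upto[of d s i d] Suc.prems(2) by simp
  have "(\<Sum>j<s (Suc d). f j (LEAST i. j < s i))
      = (\<Sum>j<s d. f j (LEAST i. j < s i)) + (\<Sum>j=s d..<s (Suc d). f j (LEAST i. j < s i))"
    using Suc.prems(2)[of d] by (simp flip: atLeast0LessThan add: sum.atLeastLessThan_concat)
  also have "(\<Sum>j=s d..<s (Suc d). f j (LEAST i. j < s i)) = (\<Sum>j=s d..<s (Suc d). f j (Suc d))"
  proof (rule sum.cong[OF refl])
    fix j assume j: "j \<in> {s d..<s (Suc d)}"
    have "(LEAST i. j < s i) = Suc d"
    proof (rule Least_equality)
      fix i assume "j < s i"
      with j mono[of i] show "Suc d \<le> i" by (meson atLeastLessThan_iff leD le_trans not_less_eq_eq)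
    qed (use j in auto)
    then show "f j (LEAST i. j < s i) = f j (Suc d)" by simp
  qed
  finally show ?case using Suc by simp
qed simp

text \<open>
  The algebra behind the numerator.  Here \<open>T\<close> and \<open>W\<close> stand for the geometric sums of \<open>t^(d-i)\<close> and
  \<open>t^(c-j)\<close>, and \<open>G\<close> for the mixed sum of \<open>t^(i \<alpha>2 + d-i)\<close>; each enters only through the closed form
  of a multiple of it.  The difference of the two sides, once \<open>T\<close> and \<open>W\<close> are eliminated, is a
  combination of the remaining two hypotheses.
\<close>
lemma numerator_identity:
  fixes t :: "'a::comm_ring_1"
  assumes T: "(1 - t) * T = t - t * X" and W: "(1 - t) * W = t - t * V"
    and G: "(Z - t) * G = t * Y - t * X" and Y: "Z * Y' = t * Y"
  shows "(1 - t) * (1 - t) * ((1 - K) + (1 - E) * (T - H) + (W - L) * (1 - Y) + W * (1 - E) * (T - G)) =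
    1 - X * t - X * t * (1 - t) * (1 - E) - K * ((1 - t) * (1 - t)) - (1 - t) * (t * (G - X + Y))
    - E * t * (1 - Y' - (1 - Z) * (G - Y')) - (1 - t) * (1 - t) * (1 - E) * H
    - (1 - Y) * ((1 - t) * (1 - t)) * L - V * t * ((1 - E * t) * (1 - Y) - (1 - Z) * (1 - E) * G)"
    (is "?lhs = ?rhs")
proof -
  let ?T = "t - t * X" and ?W = "t - t * V"
  have "?lhs = (1 - t) * (1 - t) * (1 - K) + (1 - E) * (1 - t) * ((1 - t) * T) - (1 - t) * (1 - t) * (1 - E) * H
      + ((1 - t) * W) * (1 - t) * (1 - Y) - L * ((1 - t) * (1 - t)) * (1 - Y)
      + ((1 - t) * W) * (1 - E) * ((1 - t) * T) - ((1 - t) * W) * (1 - E) * ((1 - t) * G)"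
    by (simp add: algebra_simps)
  also have "\<dots> = (1 - t) * (1 - t) * (1 - K) + (1 - E) * (1 - t) * ?T - (1 - t) * (1 - t) * (1 - E) * H
      + ?W * (1 - t) * (1 - Y) - L * ((1 - t) * (1 - t)) * (1 - Y)
      + ?W * (1 - E) * ?T - ?W * (1 - E) * ((1 - t) * G)"
    unfolding T W ..
  also have "\<dots> = ?rhs + (t * E + V * t * (1 - E)) * ((Z - t) * G - (t * Y - t * X)) - E * t * (Z * Y' - t * Y)"
    by (simp add: algebra_simps)
  also have "\<dots> = ?rhs" unfolding G Y by simp
  finally show ?thesis .
qed

section \<open>Factorizations under Komeda's relations\<close>

lemma not_less_natE:
  fixes x y :: nat
  assumes "\<not> x < y" obtains z where "x = y + z"
  using assms le_Suc_ex[of y x] by (auto simp: not_less)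

lemma not_le_natE:
  fixes x y :: nat
  assumes "\<not> x \<le> y" obtains z where "x = y + 1 + z"
  using assms less_iff_Suc_add[of y x] by (auto simp: not_le)

lemma pos_natE:
  fixes x :: nat
  assumes "0 < x" obtains z where "x = z + 1"
  using assms by (cases x) auto

text \<open>
  Komeda's parameters are \<open>A = \<alpha>1\<close>, \<open>B = \<alpha>2 = b + 1\<close>, \<open>C = \<alpha>3 = c + 1\<close>, \<open>d + 1 = \<alpha>4\<close>, \<open>e = \<alpha>21\<close> and
  \<open>g = \<alpha>1 - \<alpha>21 - 1\<close>, which removes all truncated subtractions.  The five relations are the
  binomials that generate the ideal of the semigroup; they carry the argument.  The explicit formulas
  for the generators enter beyond them through the size of \<open>n1\<close> and through \<open>s_0 = 0\<close>.  The condition \<open>e < b\<close> is \<open>\<alpha>2 > \<alpha>21 + 1\<close>.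
\<close>
locale komeda_relations =
  fixes n1 n2 n3 n4 A B C g b c d e :: nat
  assumes order: "0 < n1" "n1 < n2" "n2 < n3" "n3 < n4"
    and params: "0 < e" "0 < g" "0 < c" "0 < d" "e < b"
    and B: "B = b + 1" and C: "C = c + 1"
    and rel1: "A * n1 = n3 + d * n4"
    and rel2: "B * n2 = e * n1 + n4"
    and rel3: "C * n3 = g * n1 + n2"
    and rel4: "(d + 1) * n4 = n1 + b * n2 + c * n3"
    and rel5: "(e + 1) * n1 + c * n3 = n2 + d * n4"
begin

definition val :: "nat \<times> nat \<times> nat \<times> nat \<Rightarrow> nat" where
  "val = (\<lambda>(p, q, r, w). p * n1 + q * n2 + r * n3 + w * n4)"

definition deg :: "nat \<times> nat \<times> nat \<times> nat \<Rightarrow> nat" where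
  "deg = (\<lambda>(p, q, r, w). p + q + r + w)"

lemma val_simp [simp]: "val (p, q, r, w) = p * n1 + q * n2 + r * n3 + w * n4"
  by (simp add: val_def)

lemma deg_simp [simp]: "deg (p, q, r, w) = p + q + r + w"
  by (simp add: deg_def)

lemma deg_le_val: "deg u \<le> val u"
proof (cases u)
  case (fields p q r w)
  have "p * 1 \<le> p * n1" "q * 1 \<le> q * n2" "r * 1 \<le> r * n3" "w * 1 \<le> w * n4"
    using order by (intro mult_le_mono; simp)+
  then show ?thesis unfolding fields val_simp deg_simp by linarith
qed

text \<open>
  Since \<open>n1\<close> is the smallest generator, a factorization into copies of \<open>n1\<close> alone is the longest
  one, and strictly longer than any that does not use \<open>n1\<close>.
\<close>
lemma deg_less_pure_power:
  assumes "p' * n1 = val (0, q, r, w)" "0 < q + r + w"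
  shows "q + r + w < p'"
proof -
  have "q * n1 \<le> q * n2" "r * n1 \<le> r * n3" "w * n1 \<le> w * n4"
    using order by (intro mult_le_mono; simp)+
  moreover have "q * n1 < q * n2 \<or> r * n1 < r * n3 \<or> w * n1 < w * n4"
    using order assms(2) by auto
  ultimately have "(q + r + w) * n1 < p' * n1"
    unfolding assms(1) val_simp distrib_right by linarith
  then show ?thesis by simp
qed

text \<open>
  \<open>X1^\<alpha>1 = X3 X4^(\<alpha>4-1)\<close>, multiplied by \<open>X1^(i \<alpha>21)\<close>, where \<open>X1^\<alpha>21 X4\<close> is then replaced \<open>i\<close> times
  by \<open>X2^\<alpha>2\<close>.
\<close>
lemma rel_power_n1: "w + i = d \<Longrightarrow> (A + i * e) * n1 = val (0, i * B, 1, w)"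
  using rel1 arg_cong[OF rel2, of "\<lambda>z. i * z"] by (auto simp: algebra_simps)

text \<open>
  The family whose two sides are compared by \<open>s_i\<close>.  It starts from the last of the five relations;
  each increase of \<open>i\<close> trades one \<open>X4\<close> for \<open>X2^\<alpha>2\<close> at the cost of \<open>X1^\<alpha>21\<close>, and each increase of \<open>j\<close>
  replaces one \<open>X3\<close> by \<open>X1^\<alpha>1\<close> on the right and adds \<open>\<alpha>4-1\<close> factors \<open>X4\<close> on the left, which are
  traded for powers of \<open>X2\<close> in turn.
\<close>
lemma rel_exchange:
  assumes "w + i = d" "j \<le> c"
  shows "val (0, (d * j + i) * B + 1, 0, w)
    = val (j * A + (d * j + i + 1) * e + 1, 0, c - j, 0)"
proof -
  obtain k where k: "c = j + k" using assms(2) le_Suc_ex by blast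
  show ?thesis
    using arg_cong[OF rel2, of "\<lambda>z. (d * j + i) * z"] arg_cong[OF rel1, of "\<lambda>z. j * z"] rel5
      assms(1)[symmetric]
    by (simp add: k algebra_simps)
qed

text \<open>
  \<open>X3\<close> has the larger generator, so \<open>X3^\<alpha>3\<close> is shorter than \<open>X1^(\<alpha>1-\<alpha>21-1) X2\<close>, which has the same
  value.
\<close>
lemma alpha3_bound: "C < g + 1"
proof -
  have "c * n3 < g * n1" using rel3 C order by simp
  also have "g * n1 \<le> g * n3" using order by simp
  finally show ?thesis using C by simp
qed

text \<open>
  As \<open>n4\<close> is the largest generator, \<open>X4^\<alpha>4\<close> is shorter than \<open>X1 X2^(\<alpha>2-1) X3^(\<alpha>3-1)\<close>.
\<close>
lemma alpha4_degree_bound: "d < b + c"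
proof -
  have "b * n2 + c * n3 \<le> (b + c) * n4"
    using order by (auto simp: distrib_right intro!: add_mono mult_le_mono)
  moreover have "d * n4 + n4 = n1 + (b * n2 + c * n3)" using rel4 by simp
  ultimately have "d * n4 < (b + c) * n4" using order by linarith
  then show ?thesis by (simp only: mult_less_cancel2)
qed


lemma order_ge_iff_val: "order_ge {n1, n2, n3, n4} n x \<longleftrightarrow> (\<exists>u. val u = x \<and> n \<le> deg u)"
proof
  assume "order_ge {n1, n2, n3, n4} n x"
  then obtain v where "(\<Sum>a\<in>{n1, n2, n3, n4}. v a * a) = x" "n \<le> (\<Sum>a\<in>{n1, n2, n3, n4}. v a)"
    unfolding order_ge_def by blast
  then show "\<exists>u. val u = x \<and> n \<le> deg u"
    using order by (intro exI[of _ "(v n1, v n2, v n3, v n4)"]) (simp add: add.assoc)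
next
  assume "\<exists>u. val u = x \<and> n \<le> deg u"
  then obtain p q r w where u: "val (p, q, r, w) = x" "n \<le> deg (p, q, r, w)" by (metis prod_cases4)
  define v where "v = (\<lambda>a. if a = n1 then p else if a = n2 then q else if a = n3 then r else w)"
  have "v n1 = p" "v n2 = q" "v n3 = r" "v n4 = w" using order by (auto simp: v_def)
  then show "order_ge {n1, n2, n3, n4} n x"
    unfolding order_ge_def using order u by (intro exI[of _ v]) (simp add: add.assoc)
qed

section \<open>Factorizations with the largest exponent of \<open>X1\<close>\<close>

text \<open>
  The monomials in \<open>X2, X3, X4\<close> whose values will be the Apery set of the semigroup with respect to
  \<open>n1\<close>, the set of the smallest elements of the residue classes.
\<close>
definition apery :: "(nat \<times> nat \<times> nat) set" where
  "apery = {..<B} \<times> {..<C} \<times> {..<d} \<union> {(0, 0, d)}"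

lemma card_apery: "card apery = B * C * d + 1"
proof -
  have "card apery = card ({..<B} \<times> {..<C} \<times> {..<d}) + card {(0::nat, 0::nat, d)}"
    unfolding apery_def by (rule card_Un_disjoint) auto
  then show ?thesis by (simp add: card_cartesian_product mult.assoc)
qed

text \<open>
  Each of the five relations, read in the right direction, increases the exponent of \<open>X1\<close>.  So none
  of them applies to a factorization in which this exponent is as large as possible.
\<close>
lemma apery_representation:
  obtains p' q' r' w' where "val (p', q', r', w') = val u" "(q', r', w') \<in> apery"
proof -
  let ?F = "\<lambda>p. \<exists>q r w. val (p, q, r, w) = val u"
  have "?F (fst u)" by (cases u) auto
  moreover have "p \<le> val u" if p: "?F p" for p
  proof -
    obtain q r w where "val (p, q, r, w) = val u" using p by blast
    then show ?thesis using deg_le_val[of "(p, q, r, w)"] by simp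
  qed
  ultimately obtain p where p: "?F p" "\<And>p'. ?F p' \<Longrightarrow> p' \<le> p"
    using ex_has_greatest_nat[of ?F "fst u" "\<lambda>p. p" "val u + 1"] by (auto simp: less_Suc_eq_le)
  from p(1) obtain q r w where u: "val (p, q, r, w) = val u" by blast
  have max: "False" if "val (p + k, q', r', w') = val u" "k > 0" for k q' r' w'
    using p(2)[of "p + k"] that by auto
  have "q < B"
  proof (rule ccontr)
    assume "\<not> q < B"
    then obtain q' where "q = B + q'" by (rule not_less_natE)
    then have "val (p + e, q', r, w + 1) = val u"
      unfolding u[symmetric] using rel2 by (simp add: algebra_simps)
    then show False using max params by blast
  qed
  moreover have "r < C"
  proof (rule ccontr)
    assume "\<not> r < C"
    then obtain r' where "r = C + r'" by (rule not_less_natE)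
    then have "val (p + g, q + 1, r', w) = val u"
      unfolding u[symmetric] using rel3 by (simp add: algebra_simps)
    then show False using max params by blast
  qed
  moreover have "w \<le> d"
  proof (rule ccontr)
    assume "\<not> w \<le> d"
    then obtain w' where "w = d + 1 + w'" by (rule not_le_natE)
    then have "val (p + 1, q + b, r + c, w') = val u"
      unfolding u[symmetric] using rel4 by (simp add: algebra_simps)
    then show False using max[of 1 "q + b" "r + c" w'] by simp
  qed
  moreover have "r = 0" if "w = d"
  proof (rule ccontr)
    assume "r \<noteq> 0"
    then obtain r' where "r = r' + 1" by (cases r) auto
    then have *: "val (p + A, q, r', 0) = val u"
      unfolding u[symmetric] using rel1 that by (simp add: algebra_simps)
    have "A > 0" using rel1 order by (cases A) auto
    with * max show False by blast
  qed
  moreover have "q = 0" if "w = d"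
  proof (rule ccontr)
    assume "q \<noteq> 0"
    then obtain q' where "q = q' + 1" by (cases q) auto
    then have "val (p + (e + 1), q', r + c, 0) = val u"
      unfolding u[symmetric] using rel5 that by (simp add: algebra_simps)
    then show False using max[of "e + 1" q' "r + c" 0] by simp
  qed
  ultimately have "(q, r, w) \<in> apery" unfolding apery_def by (cases "w = d") auto
  with u that show ?thesis by blast
qed

end

locale komeda_semigroup = komeda_relations +
  assumes gcd: "Gcd {n1, n2, n3, n4} = 1"
    and n1: "n1 = B * C * d + 1"
begin

text \<open>
  Bezout coefficients of the generators, reduced modulo \<open>n1\<close> to become nonnegative.
\<close>
lemma residue_representation: "\<exists>q r w. val (0, q, r, w) mod n1 = x mod n1"
proof -
  define G3 G2 where "G3 = gcd (int n3) (int n4)" and "G2 = gcd (int n2) G3"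
  have "gcd (int n1) G2 = 1"
    using gcd unfolding G2_def G3_def by (simp add: gcd_int_int_eq)
  then obtain a1 a2 where 1: "a1 * int n1 + a2 * G2 = 1" using bezout_int by metis
  obtain a3 a4 where 2: "a3 * int n2 + a4 * G3 = G2" unfolding G2_def using bezout_int by metis
  obtain a5 a6 where 3: "a5 * int n3 + a6 * int n4 = G3" unfolding G3_def using bezout_int by metis
  have bez: "a1 * int n1 + a2 * (a3 * int n2 + a4 * (a5 * int n3 + a6 * int n4)) = 1"
    unfolding 3 2 1 ..
  define z where "z k = nat ((int x * k) mod int n1)" for k
  have z: "int (z k) = (int x * k) mod int n1" for k
    unfolding z_def using order by simp
  have "int (val (0, z (a2 * a3), z (a2 * a4 * a5), z (a2 * a4 * a6))) mod int n1
      = (int x * (a2 * a3) * int n2 + int x * (a2 * a4 * a5) * int n3 + int x * (a2 * a4 * a6) * int n4) mod int n1"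
    unfolding val_simp of_nat_add of_nat_mult z of_nat_0 mult_zero_left add_0
    by (intro mod_add_cong mod_mult_left_eq)
  also have "\<dots> = (int x * (a1 * int n1 + a2 * (a3 * int n2 + a4 * (a5 * int n3 + a6 * int n4)))) mod int n1"
  proof -
    have "int x * (a1 * int n1 + a2 * (a3 * int n2 + a4 * (a5 * int n3 + a6 * int n4)))
      = (int x * (a2 * a3) * int n2 + int x * (a2 * a4 * a5) * int n3 + int x * (a2 * a4 * a6) * int n4)
        + int n1 * (int x * a1)" by (simp add: algebra_simps)
    then show ?thesis by simp
  qed
  also have "\<dots> = int x mod int n1" unfolding bez by simp
  finally have "val (0, z (a2 * a3), z (a2 * a4 * a5), z (a2 * a4 * a6)) mod n1 = x mod n1"
    by (metis of_nat_eq_iff of_nat_mod)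
  then show ?thesis by blast
qed

text \<open>
  The \<open>n1\<close> monomials represent all residues modulo \<open>n1\<close>, so each of them only once.
\<close>
lemma inj_apery_residue: "inj_on (\<lambda>(q, r, w). val (0, q, r, w) mod n1) apery"
proof -
  have "{..<n1} \<subseteq> (\<lambda>(q, r, w). val (0, q, r, w) mod n1) ` apery"
  proof
    fix x assume "x \<in> {..<n1}"
    obtain q r w where qrw: "val (0, q, r, w) mod n1 = x mod n1"
      using residue_representation by blast
    obtain p' q' r' w' where *: "val (p', q', r', w') = val (0, q, r, w)" "(q', r', w') \<in> apery"
      using apery_representation[of "(0, q, r, w)"] .
    have "val (p', q', r', w') = n1 * p' + val (0, q', r', w')" by simp
    then have "val (0, q', r', w') mod n1 = x"
      using qrw * \<open>x \<in> {..<n1}\<close> by (metis lessThan_iff mod_less mod_mult_self4)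
    then show "x \<in> (\<lambda>(q, r, w). val (0, q, r, w) mod n1) ` apery" using *(2) by force
  qed
  moreover have "(\<lambda>(q, r, w). val (0, q, r, w) mod n1) ` apery \<subseteq> {..<n1}" using order by auto
  ultimately have eq: "(\<lambda>(q, r, w). val (0, q, r, w) mod n1) ` apery = {..<n1}" by blast
  have fin: "finite apery" unfolding apery_def by simp
  have card: "card ((\<lambda>(q, r, w). val (0, q, r, w) mod n1) ` apery) = card apery"
    unfolding eq card_apery n1[symmetric] by simp
  show ?thesis by (rule eq_card_imp_inj_on[OF fin card])
qed

lemma apery_unique:
  assumes "val (p, q, r, w) = val (p', q', r', w')" "(q, r, w) \<in> apery" "(q', r', w') \<in> apery"
  shows "p = p' \<and> q = q' \<and> r = r' \<and> w = w'"
proof -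
  have "val (p, q, r, w) = n1 * p + val (0, q, r, w)" "val (p', q', r', w') = n1 * p' + val (0, q', r', w')"
    by simp_all
  then have "val (0, q, r, w) mod n1 = val (0, q', r', w') mod n1"
    using assms(1) by (metis mod_mult_self4)
  then have "(q, r, w) = (q', r', w')"
    using inj_onD[OF inj_apery_residue, of "(q, r, w)" "(q', r', w')"] assms by simp
  then show ?thesis using assms(1) order by simp
qed

section \<open>Standard monomials\<close>

definition s :: "nat \<Rightarrow> nat" where "s = s_index A B C (d + 1) e"

text \<open>
  The defining inequality of \<open>s_i\<close> compares the lengths of the two sides of the exchange relation.
  It holds at \<open>j = c\<close>, where one side is a pure power of \<open>X1\<close>; therefore the least solution exists,
  is at most \<open>c\<close>, and the exponent \<open>c - s_i\<close> of \<open>X3\<close> is meaningful.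
\<close>
lemma s_conditions:
  assumes "i \<le> d"
  shows s_le: "s i \<le> c"
    and s_cond: "(d * s i + i) * B + 1 + (d - i) < (s i * A + (d * s i + i + 1) * e + 1) + (c - s i)"
    and s_min: "\<And>j. j < s i \<Longrightarrow> (j * A + (d * j + i + 1) * e + 1) + (c - j) \<le> (d * j + i) * B + 1 + (d - i)"
proof -
  define P where "P j \<longleftrightarrow> ((d + 1 - 1) * j + i) * B + (d + 1) - i
             < j * A + ((d + 1 - 1) * j + i + 1) * e + C - j" for j
  have s: "s i = (LEAST j. P j)" unfolding s_def s_index_def P_def ..
  have P: "P j \<longleftrightarrow> (d * j + i) * B + 1 + (d - i) < (j * A + (d * j + i + 1) * e + 1) + (c - j)"
    if "j \<le> c" for j
    using that assms C by (auto simp: P_def)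
  have "val (0, (d * c + i) * B + 1, 0, d - i) = (c * A + (d * c + i + 1) * e + 1) * n1"
    using rel_exchange[of "d - i" i c] assms by simp
  then have "P c" using deg_less_pure_power[of "c * A + (d * c + i + 1) * e + 1" "(d * c + i) * B + 1" 0 "d - i"]
    unfolding P[OF order_refl] by simp
  then show le: "s i \<le> c" unfolding s by (rule Least_le)
  have "P (s i)" unfolding s using \<open>P c\<close> by (rule LeastI)
  then show "(d * s i + i) * B + 1 + (d - i) < (s i * A + (d * s i + i + 1) * e + 1) + (c - s i)"
    using P[OF le] by simp
  fix j assume j: "j < s i"
  then have "\<not> P j" unfolding s by (rule not_less_Least)
  then show "(j * A + (d * j + i + 1) * e + 1) + (c - j) \<le> (d * j + i) * B + 1 + (d - i)"
    using P[of j] le j by simp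
qed

text \<open>
  Passing from \<open>i\<close> to \<open>i + 1\<close> lengthens the side with \<open>X2\<close> by \<open>\<alpha>2 - 1\<close> and the other one only by
  \<open>\<alpha>21\<close>, so the inequality becomes harder to satisfy.
\<close>
lemma s_Suc_mono:
  assumes "Suc i \<le> d"
  shows "s i \<le> s (Suc i)"
proof (rule ccontr)
  assume "\<not> s i \<le> s (Suc i)"
  then have lt: "s (Suc i) < s i" by simp
  define j where "j = s (Suc i)"
  have 1: "(j * A + (d * j + i + 1) * e + 1) + (c - j) \<le> (d * j + i) * B + 1 + (d - i)"
    unfolding j_def by (rule s_min) (use lt assms in auto)
  have 2: "(d * j + Suc i) * B + 1 + (d - Suc i) < (j * A + (d * j + Suc i + 1) * e + 1) + (c - j)"
    unfolding j_def by (rule s_cond) (use assms in auto)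
  have "(d * j + Suc i) * B = (d * j + i) * B + B" "(d * j + Suc i + 1) * e = (d * j + i + 1) * e + e"
    by (simp_all add: algebra_simps)
  with 1 2 assms B params show False by linarith
qed

lemma s_mono: "i \<le> i' \<Longrightarrow> i' \<le> d \<Longrightarrow> s i \<le> s i'"
  using mono_upto[of d s i i'] s_Suc_mono by blast

text \<open>
  The exponent vectors of the monomials that no replacement applies to, with \<open>i = d - w\<close> and
  \<open>j = c - r\<close> in the two families of relations.
\<close>
definition standard :: "(nat \<times> nat \<times> nat \<times> nat) set" where
  "standard = {(p, q, r, w). r \<le> c \<and> w \<le> d \<and> (0 < w \<longrightarrow> p < e) \<and>
     (r = 0 \<longrightarrow> q \<le> (d * s (d - w) + (d - w)) * B) \<and>
     (0 < r \<longrightarrow> q < (d - w) * B) \<and>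
     (w = 0 \<and> 0 < r \<longrightarrow> (\<forall>i\<le>d. c - r < s i \<longrightarrow> p \<le> (c - r) * A + (d * (c - r) + i + 1) * e))}"

text \<open>
  Take a factorization of maximal length and, among these, one with the least exponent of \<open>X1\<close>.
  Every replacement makes the factorization longer, except for the exchange relation with \<open>j < s_i\<close>,
  which may keep the length but then lowers the exponent of \<open>X1\<close>.
\<close>
lemma standard_representation:
  obtains v where "v \<in> standard" "val v = val u" "deg u \<le> deg v"
proof -
  let ?F = "\<lambda>v. val v = val u"
  obtain v0 where v0: "?F v0" "\<And>v. ?F v \<Longrightarrow> deg v \<le> deg v0"
  proof -
    have "\<forall>v. ?F v \<longrightarrow> deg v < val u + 1"
      using deg_le_val by (metis Suc_eq_plus1 le_imp_less_Suc)
    then obtain v where "?F v" "\<forall>v'. ?F v' \<longrightarrow> deg v' \<le> deg v"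
      using ex_has_greatest_nat[of ?F u deg "val u + 1"] by blast
    then show ?thesis using that by blast
  qed
  obtain v where v: "?F v \<and> deg v = deg v0" "\<And>v'. ?F v' \<and> deg v' = deg v0 \<Longrightarrow> fst v \<le> fst v'"
    using ex_has_least_nat[of "\<lambda>v. ?F v \<and> deg v = deg v0" v0 fst] v0(1) by blast
  obtain p q r w where vp: "v = (p, q, r, w)" by (cases v)
  \<comment> \<open>No factorization improves on \<open>v\<close>; each claim below exhibits one if it fails.\<close>
  have max: False if "val v' = val (p, q, r, w)" "deg (p, q, r, w) < deg v' \<or>
      deg (p, q, r, w) \<le> deg v' \<and> fst v' < p" for v'
  proof -
    have F: "?F v'" using that(1) v(1) vp by simp
    then have "deg v' \<le> deg v" using v0(2) v(1) by simp
    with that(2) vp have "deg v' = deg v" "fst v' < p" by auto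
    with v F vp show False by fastforce
  qed
  have w1: "p < e" if w0: "0 < w"
  proof (rule ccontr)
    assume "\<not> p < e"
    then obtain p' where p': "p = e + p'" by (rule not_less_natE)
    obtain w' where w': "w = w' + 1" using w0 by (rule pos_natE)
    have "val (p', q + B, r, w') = val (p, q, r, w)"
      using rel2 by (simp add: p' w' algebra_simps)
    then show False using max[of "(p', q + B, r, w')"] params B by (simp add: p' w')
  qed
  have r: "r \<le> c"
  proof (rule ccontr)
    assume "\<not> r \<le> c"
    then obtain r' where r': "r = C + r'" unfolding C by (rule not_le_natE)
    have "val (p + g, q + 1, r', w) = val (p, q, r, w)"
      using rel3 by (simp add: r' algebra_simps)
    then show False using max[of "(p + g, q + 1, r', w)"] alpha3_bound by (simp add: r')
  qed
  have w: "w \<le> d"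
  proof (rule ccontr)
    assume "\<not> w \<le> d"
    then obtain w' where w': "w = d + 1 + w'" by (rule not_le_natE)
    have "val (p + 1, q + b, r + c, w') = val (p, q, r, w)"
      using rel4 by (simp add: w' algebra_simps)
    then show False using max[of "(p + 1, q + b, r + c, w')"] alpha4_degree_bound by (simp add: w')
  qed
  define i where "i = d - w"
  have wi: "w + i = d" "i \<le> d" "w = d - i" using w by (auto simp: i_def)
  have q1: "q \<le> (d * s i + i) * B" if "r = 0"
  proof (rule ccontr)
    assume "\<not> q \<le> (d * s i + i) * B"
    then obtain q' where q': "q = (d * s i + i) * B + 1 + q'" by (rule not_le_natE)
    let ?v = "(p + (s i * A + (d * s i + i + 1) * e + 1), q', c - s i, 0)"
    have "val ?v = val (p, q, r, w)"
      using rel_exchange[OF wi(1) s_le[OF wi(2)]] that by (simp add: q' algebra_simps)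
    moreover have "deg (p, q, r, w) < deg ?v"
      using s_cond[OF wi(2)] that wi(3) by (simp add: q')
    ultimately show False using max[of ?v] by blast
  qed
  have q2: "q < i * B" if r0: "0 < r"
  proof (rule ccontr)
    assume "\<not> q < i * B"
    then obtain q' where q': "q = i * B + q'" by (rule not_less_natE)
    obtain r' where r': "r = r' + 1" using r0 by (rule pos_natE)
    let ?v = "(p + (A + i * e), q', r', 0)"
    note G = rel_power_n1[OF wi(1)]
    have "val ?v = val (p, q, r, w)"
      using G by (simp add: q' r' algebra_simps)
    moreover have "deg (p, q, r, w) < deg ?v"
      using deg_less_pure_power[OF G] by (simp add: q' r')
    ultimately show False using max[of ?v] by blast
  qed
  have p: "p \<le> (c - r) * A + (d * (c - r) + k + 1) * e"
    if k: "k \<le> d" "c - r < s k" "w = 0" "0 < r" for k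
  proof (rule ccontr)
    define j where "j = c - r"
    have jr: "j < s k" "j \<le> c" "r = c - j" using k r by (auto simp: j_def)
    assume "\<not> p \<le> (c - r) * A + (d * (c - r) + k + 1) * e"
    then obtain p' where p': "p = (j * A + (d * j + k + 1) * e + 1) + p'"
      unfolding j_def by (rule not_le_natE)
    let ?v = "(p', q + ((d * j + k) * B + 1), 0, d - k)"
    have "val ?v = val (p, q, r, w)"
      using rel_exchange[of "d - k" k j] jr k by (simp add: p' algebra_simps)
    moreover have "deg (p, q, r, w) \<le> deg ?v"
      using s_min[OF k(1) jr(1)] jr k by (simp add: p')
    moreover have "fst ?v < p" using p' by simp
    ultimately show False using max[of ?v] by blast
  qed
  have "v \<in> standard"
    using w1 r w q1 q2 p unfolding vp standard_def i_def by blast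
  moreover have "val v = val u" "deg u \<le> deg v" using v v0 by auto
  ultimately show ?thesis using that by blast
qed

text \<open>
  From a standard monomial to the factorization with the largest exponent of \<open>X1\<close>: if \<open>X2\<close> does not
  occur too often, it is enough to replace powers \<open>X2^\<alpha>2\<close> by \<open>X1^\<alpha>21 X4\<close>.
\<close>
lemma apery_of_short:
  assumes "(p, q, r, w) \<in> standard" "0 < r \<or> q \<le> (d - w) * B"
  shows "val (p + e * (q div B), q mod B, r, w + q div B) = val (p, q, r, w)"
    and "(q mod B, r, w + q div B) \<in> apery"
proof -
  define m where "m = q div B"
  have Bpos: "0 < B" using B by simp
  have q: "q = m * B + q mod B" by (simp add: m_def)
  show "val (p + e * (q div B), q mod B, r, w + q div B) = val (p, q, r, w)"
  proof -
    have "q * n2 = m * (B * n2) + (q mod B) * n2"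
      by (subst q) (simp add: algebra_simps)
    then show ?thesis unfolding rel2 m_def[symmetric] by (simp add: algebra_simps)
  qed
  have "r \<le> c" and w: "w \<le> d" using assms(1) by (auto simp: standard_def)
  then have rw: "r < C" "w \<le> d" using C by simp_all
  have "q < (d - w) * B \<or> r = 0 \<and> q = (d - w) * B"
    using assms by (auto simp: standard_def)
  then have "m < d - w \<or> r = 0 \<and> m = d - w \<and> q mod B = 0"
  proof
    assume "q < (d - w) * B"
    then show ?thesis unfolding m_def by (simp add: less_mult_imp_div_less)
  qed (use Bpos in \<open>simp add: m_def\<close>)
  then show "(q mod B, r, w + q div B) \<in> apery"
    using rw Bpos unfolding apery_def m_def[symmetric] by auto
qed

text \<open>
  In the remaining case \<open>X3\<close> does not occur, and the power of \<open>X2\<close> first absorbs one exchange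
  relation.  Division of the excess exponent \<open>q - i \<alpha>2 - 1\<close> by \<open>(\<alpha>4-1) \<alpha>2\<close> determines its index \<open>j\<close>;
  the bound on \<open>q\<close> in a standard monomial says precisely that \<open>j < s_i\<close>, so that \<open>X3\<close> occurs in the
  result.
\<close>
lemma apery_of_long:
  assumes "(p, q, r, w) \<in> standard" "\<not> (0 < r \<or> q \<le> (d - w) * B)"
  obtains j x where "j < s (d - w)" "q = (d * j + (d - w)) * B + 1 + x" "r = 0" "w \<le> d"
    "val (p + (j * A + (d * j + (d - w) + 1) * e + 1) + e * (x div B), x mod B, c - j, x div B)
      = val (p, q, r, w)"
    "(x mod B, c - j, x div B) \<in> apery"
proof -
  define i where "i = d - w"
  have st: "r = 0" "w \<le> d" "q \<le> (d * s i + i) * B" "i * B < q" "w + i = d" "i \<le> d"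
    using assms by (auto simp: standard_def i_def)
  obtain y where y: "q = i * B + 1 + y"
    using st(4) by (metis not_le not_le_natE)
  define j where "j = y div (d * B)"
  define x where "x = y mod (d * B)"
  have "y < s i * (d * B)" using st(3) y by (simp add: algebra_simps)
  then have j: "j < s i" unfolding j_def by (simp add: less_mult_imp_div_less)
  have "y = j * (d * B) + x" unfolding j_def x_def by (rule div_mult_mod_eq[symmetric])
  then have q: "q = (d * j + i) * B + 1 + x" using y by (simp add: algebra_simps)
  have x: "x < d * B" unfolding x_def using params B by simp
  have jc: "j \<le> c" "j < c" using j s_le[OF st(6)] by auto
  define m where "m = x div B"
  have xm: "x = m * B + x mod B" by (simp add: m_def)
  have "val (p + (j * A + (d * j + i + 1) * e + 1) + e * m, x mod B, c - j, m) = val (p, q, r, w)"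
  proof -
    have "x * n2 = m * (B * n2) + (x mod B) * n2"
      by (subst xm) (simp add: algebra_simps)
    then show ?thesis
      using rel_exchange[OF st(5) jc(1)] st(1) unfolding rel2 q by (simp add: algebra_simps)
  qed
  moreover have "(x mod B, c - j, m) \<in> apery"
    using x B C unfolding apery_def m_def by (auto simp: less_mult_imp_div_less)
  ultimately show ?thesis using that[of j x] j q st unfolding i_def m_def by blast
qed

text \<open>
  Equal Apery forms of the two kinds would force \<open>w = 0\<close> and an exponent of \<open>X1\<close> beyond the bound
  imposed on standard monomials by the exchange relation with \<open>j < s_i\<close>.
\<close>
lemma short_long_disjoint:
  assumes "(p, q, r, w) \<in> standard" "0 < r \<or> q \<le> (d - w) * B"
    and "(p', q', r', w') \<in> standard" "\<not> (0 < r' \<or> q' \<le> (d - w') * B)"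
  shows "val (p, q, r, w) \<noteq> val (p', q', r', w')"
proof
  assume eq: "val (p, q, r, w) = val (p', q', r', w')"
  obtain j x where jx: "j < s (d - w')" "w' \<le> d"
    "val (p' + (j * A + (d * j + (d - w') + 1) * e + 1) + e * (x div B), x mod B, c - j, x div B)
      = val (p', q', r', w')"
    "(x mod B, c - j, x div B) \<in> apery" using apery_of_long[OF assms(3,4)] by metis
  define i where "i = d - w'"
  note short = apery_of_short[OF assms(1,2)]
  from apery_unique[OF trans[OF short(1) trans[OF eq jx(3)[symmetric]]] short(2) jx(4)]
  have *: "p + e * (q div B) = p' + (j * A + (d * j + i + 1) * e + 1) + e * (x div B)"
    "r = c - j" "w + q div B = x div B" by (auto simp: i_def)
  have j: "j < s i" "i \<le> d" "j < c" using jx s_le[of i] by (auto simp: i_def)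
  have p: "p = p' + (j * A + (d * j + i + 1) * e + 1) + e * w"
    using *(1) unfolding *(3)[symmetric] by (simp add: algebra_simps)
  show False
  proof (cases "w = 0")
    case True
    have "c - r = j" "0 < r" using *(2) j by auto
    then have "p \<le> j * A + (d * j + i + 1) * e"
      using assms(1) True j by (auto simp: standard_def)
    then show False using p by simp
  next
    case False
    then have "p < e" using assms(1) by (auto simp: standard_def)
    moreover have "e \<le> e * w" using False by simp
    ultimately show False using p by simp
  qed
qed

text \<open>
  The Apery form determines the standard monomial.  Undoing the replacements could only be ambiguous
  in the number of factors \<open>X1^\<alpha>21 X4\<close> that have been produced, and in a standard monomial \<open>X1\<close> has an
  exponent below \<open>\<alpha>21\<close> as soon as \<open>X4\<close> occurs: quotient and remainder by \<open>\<alpha>21\<close> are unique.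
\<close>
lemma inj_val_standard: "inj_on val standard"
proof (rule inj_onI)
  fix u u' assume u: "u \<in> standard" "u' \<in> standard" "val u = val u'"
  obtain p q r w where up: "u = (p, q, r, w)" by (cases u)
  obtain p' q' r' w' where up': "u' = (p', q', r', w')" by (cases u')
  note st = u[unfolded up up']
  have small: "p < e" if "0 < w" using st(1) that by (auto simp: standard_def)
  have small': "p' < e" if "0 < w'" using st(2) that by (auto simp: standard_def)
  consider (ss) "0 < r \<or> q \<le> (d - w) * B" "0 < r' \<or> q' \<le> (d - w') * B"
    | (ll) "\<not> (0 < r \<or> q \<le> (d - w) * B)" "\<not> (0 < r' \<or> q' \<le> (d - w') * B)"
    | (mixed) "(0 < r \<or> q \<le> (d - w) * B) \<noteq> (0 < r' \<or> q' \<le> (d - w') * B)" by blast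
  then show "u = u'"
  proof cases
    case ss
    note s1 = apery_of_short[OF st(1) ss(1)] and s2 = apery_of_short[OF st(2) ss(2)]
    define m m' where "m = q div B" and "m' = q' div B"
    from apery_unique[OF trans[OF s1(1) trans[OF st(3) s2(1)[symmetric]]] s1(2) s2(2)]
    have *: "p + e * m = p' + e * m'" "q mod B = q' mod B" "r = r'" "w + m = w' + m'"
      by (auto simp: m_def m'_def)
    have "m = m'"
    proof (rule ccontr)
      have less: False if "x < y" "v' + y = v + x" "0 < v \<Longrightarrow> a < e" "a + e * x = a' + e * y" for x y a a' v v'
      proof -
        have "e * Suc x \<le> e * y" using that(1) by (intro mult_le_mono2) simp
        then show False using that by simp
      qed
      assume "m \<noteq> m'"
      then show False
        using less[of m m' w' w p p'] less[of m' m w w' p' p] small small' *(1,4) by (metis nat_neq_iff)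
    qed
    moreover from this *(2) have "q = q'" unfolding m_def m'_def by (metis div_mult_mod_eq)
    ultimately show ?thesis using * up up' by simp
  next
    case ll
    obtain j x where jx: "q = (d * j + (d - w)) * B + 1 + x" "j < s (d - w)" "r = 0" "w \<le> d"
      "val (p + (j * A + (d * j + (d - w) + 1) * e + 1) + e * (x div B), x mod B, c - j, x div B)
        = val (p, q, r, w)" "(x mod B, c - j, x div B) \<in> apery" using apery_of_long[OF st(1) ll(1)] by metis
    obtain j' x' where jx': "q' = (d * j' + (d - w')) * B + 1 + x'" "j' < s (d - w')" "r' = 0" "w' \<le> d"
      "val (p' + (j' * A + (d * j' + (d - w') + 1) * e + 1) + e * (x' div B), x' mod B, c - j', x' div B)
        = val (p', q', r', w')" "(x' mod B, c - j', x' div B) \<in> apery" using apery_of_long[OF st(2) ll(2)] by metis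
    from apery_unique[OF trans[OF jx(5) trans[OF st(3) jx'(5)[symmetric]]] jx(6) jx'(6)]
    have *: "p + (j * A + (d * j + (d - w) + 1) * e + 1) + e * (x div B)
        = p' + (j' * A + (d * j' + (d - w') + 1) * e + 1) + e * (x' div B)"
      "x mod B = x' mod B" "c - j = c - j'" "x div B = x' div B" by auto
    have x: "x = x'" using *(2,4) by (metis div_mult_mod_eq)
    have "j \<le> c" "j' \<le> c" using jx jx' s_le[of "d - w"] s_le[of "d - w'"] by auto
    with *(3) have j: "j = j'" by simp
    have pe: "p + (d - w) * e = p' + (d - w') * e" using *(1) unfolding x j by (simp add: algebra_simps)
    have less: False if "v < v'" "v' \<le> d" "a + (d - v) * e = a' + (d - v') * e" "a' < e" for a a' v v'
    proof -
      have "Suc (d - v') \<le> d - v" using that by linarith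
      from mult_le_mono1[OF this, of e] have "(d - v') * e + e \<le> (d - v) * e" by simp
      then show False using that(3,4) by simp
    qed
    have "w = w'"
    proof (rule ccontr)
      assume "w \<noteq> w'"
      then consider "w < w'" | "w' < w" by linarith
      then show False
        using less[of w w' p p'] less[of w' w p' p] small small' pe jx(4) jx'(4) by cases auto
    qed
    with pe have "p = p'" by simp
    with x j \<open>w = w'\<close> jx jx' show ?thesis using up up' by simp
  next
    case mixed
    then show ?thesis
      using short_long_disjoint[OF st(1) _ st(2)] short_long_disjoint[OF st(2) _ st(1)] st(3) by metis
  qed
qed

text \<open>
  A standard monomial is a longest factorization of its value: a longer one would lead to a longer
  standard monomial of the same value, contradicting uniqueness.
\<close>
lemma card_order_eq:
  "card {x. order_ge {n1, n2, n3, n4} n x \<and> \<not> order_ge {n1, n2, n3, n4} (Suc n) x}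
    = card {u \<in> standard. deg u = n}"
proof -
  have max: "deg v \<le> deg u" if "u \<in> standard" "val v = val u" for u v
  proof -
    obtain v' where "v' \<in> standard" "val v' = val v" "deg v \<le> deg v'"
      using standard_representation[of v] .
    then show ?thesis using inj_onD[OF inj_val_standard] that by metis
  qed
  have image: "val ` {u \<in> standard. deg u = n}
      = {x. order_ge {n1, n2, n3, n4} n x \<and> \<not> order_ge {n1, n2, n3, n4} (Suc n) x}"
  proof (intro subset_antisym subsetI)
    fix x assume "x \<in> val ` {u \<in> standard. deg u = n}"
    then obtain u where "u \<in> standard" "deg u = n" "x = val u" by blast
    then show "x \<in> {x. order_ge {n1, n2, n3, n4} n x \<and> \<not> order_ge {n1, n2, n3, n4} (Suc n) x}"
      using max[of u] unfolding order_ge_iff_val by fastforce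
  next
    fix x assume "x \<in> {x. order_ge {n1, n2, n3, n4} n x \<and> \<not> order_ge {n1, n2, n3, n4} (Suc n) x}"
    then obtain v where v: "val v = x" "n \<le> deg v" "\<And>u. val u = x \<Longrightarrow> \<not> Suc n \<le> deg u"
      unfolding order_ge_iff_val by blast
    obtain u where u: "u \<in> standard" "val u = val v" "deg v \<le> deg u"
      using standard_representation[of v] .
    then have "deg u = n" using v(1,2) v(3)[of u] by simp
    then show "x \<in> val ` {u \<in> standard. deg u = n}" using u v(1) by (intro image_eqI[of _ _ u]) auto
  qed
  have "inj_on val {u \<in> standard. deg u = n}"
    by (rule inj_on_subset[OF inj_val_standard]) auto
  from card_image[OF this] show ?thesis unfolding image .
qed


section \<open>The generating function of the standard monomials\<close>

text \<open>
  For fixed \<open>r\<close> and \<open>w\<close> the exponents \<open>p\<close> and \<open>q\<close> of \<open>X1\<close> and \<open>X2\<close> in a standard monomial vary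
  independently.  Among the bounds on \<open>p\<close> from the exchange relations the one with the first \<open>i\<close>
  such that \<open>j < s_i\<close> is the sharpest.
\<close>
definition p_limit :: "nat \<Rightarrow> nat" where
  "p_limit j = j * A + (d * j + (LEAST i. j < s i) + 1) * e + 1"

definition p_range :: "nat \<Rightarrow> nat \<Rightarrow> nat set" where
  "p_range r w = (if 0 < w then {..<e} else if r = 0 \<or> s d \<le> c - r then UNIV else {..<p_limit (c - r)})"

definition q_limit :: "nat \<Rightarrow> nat \<Rightarrow> nat" where
  "q_limit r w = (if r = 0 then (d * s (d - w) + (d - w)) * B + 1 else (d - w) * B)"

lemma p_limit_iff:
  "(\<forall>i\<le>d. j < s i \<longrightarrow> p \<le> j * A + (d * j + i + 1) * e) \<longleftrightarrow> s d \<le> j \<or> p < p_limit j"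
proof (cases "s d \<le> j")
  case True
  then show ?thesis using s_mono[of _ d] by fastforce
next
  case False
  define i0 where "i0 = (LEAST i. j < s i)"
  have i0: "j < s i0" "i0 \<le> d"
    using False LeastI[of "\<lambda>i. j < s i" d] Least_le[of "\<lambda>i. j < s i" d] by (auto simp: i0_def)
  have min: "i0 \<le> i" if "j < s i" for i unfolding i0_def using that by (rule Least_le)
  have "(\<forall>i\<le>d. j < s i \<longrightarrow> p \<le> j * A + (d * j + i + 1) * e) \<longleftrightarrow> p \<le> j * A + (d * j + i0 + 1) * e"
  proof
    assume p: "p \<le> j * A + (d * j + i0 + 1) * e"
    show "\<forall>i\<le>d. j < s i \<longrightarrow> p \<le> j * A + (d * j + i + 1) * e"
    proof (intro allI impI)
      fix i assume "j < s i"
      then have "(d * j + i0 + 1) * e \<le> (d * j + i + 1) * e" using min by (intro mult_le_mono1) simp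
      with p show "p \<le> j * A + (d * j + i + 1) * e" by linarith
    qed
  qed (use i0 in blast)
  then show ?thesis using False by (simp add: p_limit_def i0_def less_Suc_eq_le)
qed

lemma standard_boxes:
  "standard = (\<Union>(r, w)\<in>{..c} \<times> {..d}. (\<lambda>(p, q). (p, q, r, w)) ` (p_range r w \<times> {..<q_limit r w}))"
  (is "_ = ?U")
proof (rule Set.set_eqI)
  fix u :: "nat \<times> nat \<times> nat \<times> nat"
  obtain p q r w where u: "u = (p, q, r, w)" by (cases u)
  have "u \<in> ?U \<longleftrightarrow> r \<le> c \<and> w \<le> d \<and> p \<in> p_range r w \<and> q < q_limit r w"
  proof
    assume *: "r \<le> c \<and> w \<le> d \<and> p \<in> p_range r w \<and> q < q_limit r w"
    then have "u \<in> (\<lambda>(p, q). (p, q, r, w)) ` (p_range r w \<times> {..<q_limit r w})"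
      unfolding u by (intro image_eqI[of _ _ "(p, q)"]) simp_all
    with * show "u \<in> ?U" by (intro UN_I[of "(r, w)"]) simp_all
  qed (auto simp: u)
  also have "\<dots> \<longleftrightarrow> u \<in> standard"
    unfolding u standard_def p_limit_iff
    by (auto simp: p_range_def q_limit_def)
  finally show "u \<in> standard \<longleftrightarrow> u \<in> ?U" by simp
qed

lemma box_gf:
  "(1 - fps_X)\<^sup>2 * count_gf ((\<lambda>(p, q). (p, q, r, w)) ` (p_range r w \<times> {..<q_limit r w})) deg
    = fps_X ^ (r + w) * (if 0 < w then 1 - fps_X ^ e else
        if r = 0 \<or> s d \<le> c - r then 1 else 1 - fps_X ^ p_limit (c - r)) * (1 - fps_X ^ q_limit r w)"
proof -
  have fin: "finite {x \<in> X. x = n}" for X and n :: nat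
    by (rule finite_subset[of _ "{n}"]) auto
  have P: "(1 - fps_X) * count_gf (p_range r w) (\<lambda>x. x) = (if 0 < w then 1 - fps_X ^ e else
        if r = 0 \<or> s d \<le> c - r then 1 else 1 - fps_X ^ p_limit (c - r))"
    by (simp add: p_range_def count_gf_lessThan count_gf_UNIV)
  have "count_gf ((\<lambda>(p, q). (p, q, r, w)) ` (p_range r w \<times> {..<q_limit r w})) deg
      = count_gf (p_range r w \<times> {..<q_limit r w}) (\<lambda>z. deg ((\<lambda>(p, q). (p, q, r, w)) z))"
    by (rule count_gf_image) (auto simp: inj_on_def)
  also have "(\<lambda>z. deg ((\<lambda>(p, q). (p, q, r, w)) z)) = (\<lambda>z. (r + w) + (case z of (p, q) \<Rightarrow> p + q))"
    by (auto simp: fun_eq_iff)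
  also have "count_gf (p_range r w \<times> {..<q_limit r w}) \<dots>
      = fps_X ^ (r + w) * (count_gf (p_range r w) (\<lambda>x. x) * count_gf {..<q_limit r w} (\<lambda>x. x))"
    unfolding count_gf_shift by (subst count_gf_times[OF fin fin]) (rule refl)
  finally have "(1 - fps_X)\<^sup>2 * count_gf ((\<lambda>(p, q). (p, q, r, w)) ` (p_range r w \<times> {..<q_limit r w})) deg
    = fps_X ^ (r + w) * ((1 - fps_X) * count_gf (p_range r w) (\<lambda>x. x))
        * ((1 - fps_X) * count_gf {..<q_limit r w} (\<lambda>x. x))"
    by (simp add: power2_eq_square mult_ac)
  then show ?thesis unfolding P count_gf_lessThan .
qed

lemma standard_gf_sum:
  "(1 - fps_X)\<^sup>2 * count_gf standard deg =
    (\<Sum>r\<le>c. \<Sum>w\<le>d. fps_X ^ (r + w) * (if 0 < w then 1 - fps_X ^ e else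
        if r = 0 \<or> s d \<le> c - r then 1 else 1 - fps_X ^ p_limit (c - r)) * (1 - fps_X ^ q_limit r w))"
proof -
  have fin: "finite {u. deg u = n}" for n
    by (rule finite_subset[of _ "{..n} \<times> {..n} \<times> {..n} \<times> {..n}"]) (auto simp: deg_def)
  define box where
    "box = (\<lambda>(r, w). (\<lambda>(p, q). (p, q, r, w)) ` (p_range r w \<times> {..<q_limit r w}))"
  define F where "F = (\<lambda>r w. fps_X ^ (r + w) * (if 0 < w then 1 - fps_X ^ e else
        if r = 0 \<or> s d \<le> c - r then 1 else 1 - fps_X ^ p_limit (c - r)) * (1 - fps_X ^ q_limit r w) :: rat fps)"
  have standard: "standard = (\<Union>z\<in>{..c} \<times> {..d}. box z)"
    unfolding box_def by (rule standard_boxes)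
  have "count_gf standard deg = (\<Sum>z\<in>{..c} \<times> {..d}. count_gf (box z) deg)"
    unfolding standard
  proof (rule count_gf_UN)
    fix y z :: "nat \<times> nat" assume "y \<noteq> z"
    then show "box y \<inter> box z = {}" by (auto simp: box_def)
  next
    fix z :: "nat \<times> nat" and n show "finite {u \<in> box z. deg u = n}" by (rule finite_subset[OF _ fin[of n]]) blast
  qed simp
  then have "(1 - fps_X)\<^sup>2 * count_gf standard deg
      = (\<Sum>z\<in>{..c} \<times> {..d}. (1 - fps_X)\<^sup>2 * count_gf (box z) deg)"
    by (simp only: sum_distrib_left)
  also have "\<dots> = (\<Sum>(r, w)\<in>{..c} \<times> {..d}. F r w)"
  proof (rule sum.cong[OF refl])
    fix z show "(1 - fps_X)\<^sup>2 * count_gf (box z) deg = (case z of (r, w) \<Rightarrow> F r w)"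
      unfolding box_def F_def by (cases z) (simp only: case_prod_conv box_gf)
  qed
  also have "\<dots> = (\<Sum>r\<le>c. \<Sum>w\<le>d. F r w)" by (rule sum.cartesian_product[symmetric])
  finally show ?thesis unfolding F_def .
qed

text \<open>
  The rectangles, grouped by whether \<open>X3\<close> and \<open>X4\<close> occur and indexed by \<open>i = d - w\<close> and \<open>j = c - r\<close>.
\<close>
lemma standard_gf:
  fixes t :: "rat fps"
  assumes "t = fps_X"
  shows "(1 - t)\<^sup>2 * count_gf standard deg =
    (1 - t ^ ((d * s d + d) * B + 1))
    + (1 - t ^ e) * ((\<Sum>i<d. t ^ (d - i)) - (\<Sum>i<d. t ^ ((d * s i + i) * B + 1 + (d - i))))
    + ((\<Sum>j<c. t ^ (c - j)) - (\<Sum>j<s d. t ^ (p_limit j + (c - j)))) * (1 - t ^ (d * B))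
    + (\<Sum>j<c. t ^ (c - j)) * (1 - t ^ e) * ((\<Sum>i<d. t ^ (d - i)) - (\<Sum>i<d. t ^ (i * B + (d - i))))"
proof -
  define F where "F r w = t ^ (r + w) * (if 0 < w then 1 - t ^ e else
        if r = 0 \<or> s d \<le> c - r then 1 else 1 - t ^ p_limit (c - r)) * (1 - t ^ q_limit r w)" for r w
  have "(1 - t)\<^sup>2 * count_gf standard deg = (\<Sum>r\<le>c. \<Sum>w\<le>d. F r w)"
    unfolding F_def assms by (rule standard_gf_sum)
  also have "\<dots> = (F 0 0 + (\<Sum>i<d. F 0 (d - i))) + (\<Sum>j<c. F (c - j) 0 + (\<Sum>i<d. F (c - j) (d - i)))"
    unfolding sum_atMost_backwards ..
  also have "F 0 0 = 1 - t ^ ((d * s d + d) * B + 1)"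
    by (simp add: F_def q_limit_def)
  also have "(\<Sum>i<d. F 0 (d - i)) =
      (1 - t ^ e) * ((\<Sum>i<d. t ^ (d - i)) - (\<Sum>i<d. t ^ ((d * s i + i) * B + 1 + (d - i))))"
    unfolding sum_subtractf[symmetric] sum_distrib_left
    by (rule sum.cong[OF refl]) (unfold F_def q_limit_def power_add, simp add: power_add algebra_simps)
  also have "(\<Sum>j<c. F (c - j) 0 + (\<Sum>i<d. F (c - j) (d - i)))
     = (\<Sum>j<c. F (c - j) 0) + (\<Sum>j<c. \<Sum>i<d. F (c - j) (d - i))" by (rule sum.distrib)
  also have "(\<Sum>j<c. F (c - j) 0) =
      ((\<Sum>j<c. t ^ (c - j)) - (\<Sum>j<s d. t ^ (p_limit j + (c - j)))) * (1 - t ^ (d * B))"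
  proof -
    have "(\<Sum>j<s d. t ^ (p_limit j + (c - j))) = (\<Sum>j<c. if j < s d then t ^ (p_limit j + (c - j)) else 0)"
      using s_le[of d] by (intro sum.mono_neutral_cong_left) auto
    then show ?thesis
      unfolding sum_subtractf[symmetric] sum_distrib_right
      by (simp only: sum_subtractf[symmetric] sum_distrib_right)
        (rule sum.cong[OF refl], unfold F_def q_limit_def power_add, auto simp: power_add algebra_simps)
  qed
  also have "(\<Sum>j<c. \<Sum>i<d. F (c - j) (d - i)) =
      (\<Sum>j<c. t ^ (c - j)) * (1 - t ^ e) * ((\<Sum>i<d. t ^ (d - i)) - (\<Sum>i<d. t ^ (i * B + (d - i))))"
    unfolding sum_subtractf[symmetric] sum_distrib_right
    unfolding sum_distrib_left
    by (intro sum.cong[OF refl], unfold F_def q_limit_def power_add, auto simp: power_add algebra_simps)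
  finally show ?thesis by (simp only: add.assoc)
qed


lemma sum_p_limit:
  fixes t :: "rat fps"
  assumes "s 0 = 0"
  shows "(\<Sum>j<s d. t ^ (p_limit j + (c - j)))
    = (\<Sum>i=1..d. \<Sum>j=s (i - 1)..<s i. t ^ (j * A + (d * j + (i + 1)) * e + (c + 1) - j))"
proof -
  have "(\<Sum>j<s d. t ^ (p_limit j + (c - j)))
      = (\<Sum>i=1..d. \<Sum>j=s (i - 1)..<s i. t ^ (j * A + (d * j + i + 1) * e + 1 + (c - j)))"
    unfolding p_limit_def
    by (rule sum_first_exceeding[where f = "\<lambda>j i. t ^ (j * A + (d * j + i + 1) * e + 1 + (c - j))",
          OF assms s_Suc_mono])
  also have "\<dots> = (\<Sum>i=1..d. \<Sum>j=s (i - 1)..<s i. t ^ (j * A + (d * j + (i + 1)) * e + (c + 1) - j))"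
  proof (intro sum.cong[OF refl] arg_cong[of _ _ "\<lambda>k. t ^ k"])
    fix i j assume "i \<in> {1..d}" "j \<in> {s (i - 1)..<s i}"
    then have "j \<le> c" using s_le[of i] by auto
    then show "j * A + (d * j + i + 1) * e + 1 + (c - j) = j * A + (d * j + (i + 1)) * e + (c + 1) - j"
      by (simp add: add.assoc)
  qed
  finally show ?thesis .
qed

lemma hilbert_numerator:
  fixes t :: "rat fps"
  assumes t: "t = fps_X" and s0: "s 0 = 0"
  shows "(1 - t) ^ 4 * count_gf standard deg =
      1 - t ^ (d + 1) - t ^ (d + 1) * (1 - t) * (1 - t ^ e)
      - t ^ ((d * s d + d) * B + 1) * (1 - t)\<^sup>2
      - (1 - t) * (\<Sum>j = 1..d. t ^ (j * B + (d + 1 - j)))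
      - t ^ (e + 1) *
          (1 - t ^ ((d - 1) * B + 1)
           - (1 - t ^ B) * (\<Sum>j < d - 1. t ^ (j * B + (d - j))))
      - (1 - t)\<^sup>2 * (1 - t ^ e) *
          (\<Sum>i<d. t ^ ((d * s i + i) * B + 1 + (d - i)))
      - (1 - t ^ (d * B)) * (1 - t)\<^sup>2 *
          (\<Sum>i = 1..d. \<Sum>j = s (i - 1)..<s i. t ^ (j * A + (d * j + (i + 1)) * e + (c + 1) - j))
      - t ^ (c + 1) *
          ((1 - t ^ (e + 1)) * (1 - t ^ (d * B))
           - (1 - t ^ B) * (1 - t ^ e) * (\<Sum>j<d. t ^ (j * B + (d - j))))"
proof -
  define G where "G = (\<Sum>j<d. t ^ (j * B + (d - j)))"
  define H where "H = (\<Sum>i<d. t ^ ((d * s i + i) * B + 1 + (d - i)))"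
  define L where "L = (\<Sum>i = 1..d. \<Sum>j = s (i - 1)..<s i. t ^ (j * A + (d * j + (i + 1)) * e + (c + 1) - j))"
  define T where "T = (\<Sum>i<d. t ^ (d - i))"
  define W where "W = (\<Sum>j<c. t ^ (c - j))"
  define Y where "Y = t ^ (d * B)"
  define K where "K = t ^ ((d * s d + d) * B + 1)"
  have geo: "(1 - t) * (\<Sum>i<n. t ^ (n - i)) = t - t * t ^ n" for n
  proof -
    have "(\<Sum>i<n. t ^ (n - i)) = t * (\<Sum>i<n. t ^ (n - Suc i))"
      unfolding sum_distrib_left by (rule sum.cong) (auto simp: Suc_diff_Suc simp flip: power_Suc)
    also have "(\<Sum>i<n. t ^ (n - Suc i)) = (\<Sum>i<n. t ^ i)" by (rule sum.nat_diff_reindex)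
    finally have "(1 - t) * (\<Sum>i<n. t ^ (n - i)) = t * ((1 - t) * (\<Sum>i<n. t ^ i))"
      by (simp add: mult_ac)
    then show ?thesis by (simp add: one_diff_power_eq[symmetric] right_diff_distrib)
  qed
  have T: "(1 - t) * T = t - t * t ^ d" unfolding T_def by (rule geo)
  have W: "(1 - t) * W = t - t * t ^ c" unfolding W_def by (rule geo)
  have G: "(t ^ B - t) * G = t * Y - t * t ^ d"
  proof -
    have "(t ^ B - t) * G = (\<Sum>j<d. t * t ^ (Suc j * B + (d - Suc j)) - t * t ^ (j * B + (d - j)))"
      unfolding G_def sum_distrib_left
    proof (rule sum.cong[OF refl])
      fix j assume j: "j \<in> {..<d}"
      define k where "k = d - Suc j"
      have k: "d - j = Suc k" "d - Suc j = k" using j by (simp_all add: k_def Suc_diff_Suc)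
      show "(t ^ B - t) * t ^ (j * B + (d - j))
          = t * t ^ (Suc j * B + (d - Suc j)) - t * t ^ (j * B + (d - j))"
        unfolding k by (simp add: power_add algebra_simps)
    qed
    also have "\<dots> = t * t ^ (d * B + (d - d)) - t * t ^ (0 * B + (d - 0))"
      by (rule sum_lessThan_telescope)
    finally show ?thesis by (simp add: Y_def)
  qed
  have G1: "(\<Sum>j = 1..d. t ^ (j * B + (d + 1 - j))) = t * (G - t ^ d + Y)"
  proof -
    have "(\<Sum>j<Suc d. t ^ (j * B + (d - j))) = G + Y" by (simp add: G_def Y_def)
    moreover have "(\<Sum>j<Suc d. t ^ (j * B + (d - j))) = t ^ d + (\<Sum>j=1..d. t ^ (j * B + (d - j)))"
      unfolding sum.lessThan_Suc_shift One_nat_def sum.atLeast1_atMost_eq by simp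
    moreover have "(\<Sum>j = 1..d. t ^ (j * B + (d + 1 - j))) = t * (\<Sum>j=1..d. t ^ (j * B + (d - j)))"
      unfolding sum_distrib_left by (rule sum.cong) (auto simp: Suc_diff_le)
    ultimately show ?thesis by (simp add: algebra_simps)
  qed
  have d: "Suc (d - 1) = d" using params by simp
  have G2: "(\<Sum>j<d - 1. t ^ (j * B + (d - j))) = G - t ^ ((d - 1) * B + 1)"
    unfolding G_def using sum.lessThan_Suc[of "\<lambda>j. t ^ (j * B + (d - j))" "d - 1"] params unfolding d by simp
  have Y: "t ^ B * t ^ ((d - 1) * B + 1) = t * Y"
    unfolding Y_def using arg_cong[OF d, of "\<lambda>k. k * B"] by (simp flip: power_add power_Suc)
  have "(1 - t) ^ 4 * count_gf standard deg = (1 - t)\<^sup>2 * ((1 - t)\<^sup>2 * count_gf standard deg)"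
    by (simp add: power2_eq_square power4_eq_xxxx mult_ac)
  also have "\<dots> = (1 - t)\<^sup>2 * ((1 - K) + (1 - t ^ e) * (T - H) + (W - L) * (1 - Y) + W * (1 - t ^ e) * (T - G))"
    unfolding standard_gf[OF t] sum_p_limit[OF s0] K_def T_def H_def W_def L_def Y_def G_def ..
  finally have eq: "(1 - t) ^ 4 * count_gf standard deg = (1 - t)\<^sup>2 *
    ((1 - K) + (1 - t ^ e) * (T - H) + (W - L) * (1 - Y) + W * (1 - t ^ e) * (T - G))" .
  define Y' where "Y' = t ^ ((d - 1) * B + 1)"
  have t1: "t ^ (k + 1) = t ^ k * t" for k by simp
  show ?thesis
    unfolding eq G1 G2 G_def[symmetric] H_def[symmetric] L_def[symmetric] Y_def[symmetric]
      K_def[symmetric] Y'_def[symmetric]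
    unfolding t1 power2_eq_square
    by (rule numerator_identity[OF T W G Y[folded Y'_def]])
qed

end

section \<open>The numerator of the Hilbert series\<close>

text \<open>
  This is what forces \<open>s_0 = 0\<close>.  From \<open>n1 < n2\<close> one gets
  \<open>(\<alpha>4-1)(\<alpha>2-\<alpha>21) < \<alpha>1\<close>.  If \<open>\<alpha>4 - 1 = \<alpha>21 + \<alpha>3 - 1 + k\<close> with \<open>k \<ge> 0\<close>, then inserting \<open>\<alpha>3 - 1 = \<alpha>4 - 1 - \<alpha>21 - k\<close> and this lower
  bound for \<open>\<alpha>1\<close> into the formulas gives \<open>n3 \<ge> n4\<close>.
\<close>
lemma s_index_0_bound:
  fixes b c d e g :: nat
  assumes "0 < e" "e < b" "0 < d"
    and n12: "(b + 1) * (c + 1) * d + 1 < e * (c + 1) * (d + 1) + g * c + (c + 1)"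
    and n34: "(e + g) * (d + 1) + 1 + g * b * d < (e + 1 + g) * (b + 1) * c + e * b + b + 1"
  shows "d < e + c"
proof (rule ccontr)
  assume "\<not> d < e + c"
  then obtain k where d: "d = e + c + k" using not_less_natE by blast
  define b' c' d' e' g' k' where int: "b' = int b" "c' = int c" "d' = int d" "e' = int e" "g' = int g" "k' = int k"
  \<comment> \<open>\<open>S\<close> is \<open>\<alpha>1\<close>.\<close>
  define S where "S = e' + 1 + g'"
  have pos: "1 \<le> e'" "e' + 1 \<le> b'" "1 \<le> d'" "0 \<le> c'" "0 \<le> k'" "0 \<le> g'"
    using assms(1-3) by (auto simp: int)
  have 12: "(b' + 1) * (c' + 1) * d' + 1 < e' * (c' + 1) * (d' + 1) + g' * c' + (c' + 1)"
    using n12 unfolding int by (metis (no_types) of_nat_1 of_nat_add of_nat_less_iff of_nat_mult)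
  have 34: "(e' + g') * (d' + 1) + 1 + g' * b' * d' < (e' + 1 + g') * (b' + 1) * c' + e' * b' + b' + 1"
    using n34 unfolding int by (metis (no_types) of_nat_1 of_nat_add of_nat_less_iff of_nat_mult)
  have S1: "d' * (b' + 1 - e') + 1 \<le> S"
  proof (rule ccontr)
    assume "\<not> d' * (b' + 1 - e') + 1 \<le> S"
    then have "S \<le> d' * (b' + 1 - e')" by simp
    then have "(c' + 1) * S \<le> (c' + 1) * (d' * (b' + 1 - e'))" using pos by (intro mult_left_mono) auto
    with 12 pos show False by (simp add: S_def algebra_simps)
  qed
  have "d' * 2 \<le> d' * (b' + 1 - e')" using pos by (intro mult_left_mono) auto
  with S1 have S2: "2 * d' + 1 \<le> S" by simp
  have "1 * (b' + 1 - e') \<le> d' * (b' + 1 - e')" using pos by (intro mult_right_mono) auto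
  with S1 have S3: "b' + 2 - e' \<le> S" by simp
  have c: "c' = d' - e' - k'" using d by (simp add: int)
  have "(2 * d' + 1) * ((b' + 1) * e') \<le> S * ((b' + 1) * (e' + k'))"
    using S2 pos by (intro mult_mono mult_left_mono) auto
  moreover have "S - 1 - d' - (e' + 1) * b' * d' + S * ((b' + 1) * (e' + k')) - (e' + 1) * b' < 0"
    using 34 unfolding c by (simp add: S_def algebra_simps)
  ultimately have "S - 1 - d' - (e' + 1) * b' * d' + (2 * d' + 1) * ((b' + 1) * e') - (e' + 1) * b' < 0"
    by linarith
  then have "(S - 1 - b' + e') + d' * (b' * (e' - 1) + (2 * e' - 1)) < 0"
    by (simp add: algebra_simps)
  moreover have "0 \<le> d' * (b' * (e' - 1) + (2 * e' - 1))" using pos by simp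
  ultimately show False using S3 by linarith
qed

theorem theorem4p1:
  fixes n1 n2 n3 n4 \<alpha>1 \<alpha>2 \<alpha>3 \<alpha>4 \<alpha>21 :: nat
    and s :: "nat \<Rightarrow> nat"
    and R :: "'k::alg_closed_field fps ring"
    and \<mm> :: "'k fps set"
    and t P :: "rat fps"
  assumes order: "0 < n1" "n1 < n2" "n2 < n3" "n3 < n4"
    and gcd: "Gcd {n1, n2, n3, n4} = 1"
    and four_generated: "minimal_generators {n1, n2, n3, n4}"
    and pseudo_symmetric: "pseudo_symmetric (semigroup_of {n1, n2, n3, n4})"
    and alpha: "1 < \<alpha>1" "1 < \<alpha>2" "1 < \<alpha>3" "1 < \<alpha>4" "0 < \<alpha>21" "\<alpha>21 < \<alpha>1 - 1"
    and n1: "n1 = \<alpha>2 * \<alpha>3 * (\<alpha>4 - 1) + 1"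
    and n2: "n2 = \<alpha>21 * \<alpha>3 * \<alpha>4 + (\<alpha>1 - \<alpha>21 - 1) * (\<alpha>3 - 1) + \<alpha>3"
    and n3: "n3 = \<alpha>1 * \<alpha>4 + (\<alpha>1 - \<alpha>21 - 1) * (\<alpha>2 - 1) * (\<alpha>4 - 1) - \<alpha>4 + 1"
    and n4: "n4 = \<alpha>1 * \<alpha>2 * (\<alpha>3 - 1) + \<alpha>21 * (\<alpha>2 - 1) + \<alpha>2"
    and alpha2: "\<alpha>21 + 1 < \<alpha>2"
    and s: "s = s_index \<alpha>1 \<alpha>2 \<alpha>3 \<alpha>4 \<alpha>21"
    and R: "R = semigroup_ring {n1, n2, n3, n4}"
    and \<mm>: "\<mm> = semigroup_max_ideal {n1, n2, n3, n4}"
    and t: "t = fps_X"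
    and P: "hilbert_series R \<mm> = P / (1 - t) ^ 4"
  shows "P =
      1 - t ^ \<alpha>4 - t ^ \<alpha>4 * (1 - t) * (1 - t ^ \<alpha>21)
      - t ^ (((\<alpha>4 - 1) * s (\<alpha>4 - 1) + \<alpha>4 - 1) * \<alpha>2 + 1) * (1 - t)\<^sup>2
      - (1 - t) * (\<Sum>j = 1..\<alpha>4 - 1. t ^ (j * \<alpha>2 + (\<alpha>4 - j)))
      - t ^ (\<alpha>21 + 1) *
          (1 - t ^ ((\<alpha>4 - 2) * \<alpha>2 + 1)
           - (1 - t ^ \<alpha>2) * (\<Sum>j < \<alpha>4 - 2. t ^ (j * \<alpha>2 + (\<alpha>4 - 1 - j))))
      - (1 - t)\<^sup>2 * (1 - t ^ \<alpha>21) *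
          (\<Sum>j = 0..\<alpha>4 - 2. t ^ (((\<alpha>4 - 1) * s j + j) * \<alpha>2 + \<alpha>4 - j))
      - (1 - t ^ ((\<alpha>4 - 1) * \<alpha>2)) * (1 - t)\<^sup>2 *
          (\<Sum>i = 1..\<alpha>4 - 1. \<Sum>j = s (i - 1)..<s i.
             t ^ (j * \<alpha>1 + ((\<alpha>4 - 1) * j + (i + 1)) * \<alpha>21 + \<alpha>3 - j))
      - t ^ \<alpha>3 *
          ((1 - t ^ (\<alpha>21 + 1)) * (1 - t ^ ((\<alpha>4 - 1) * \<alpha>2))
           - (1 - t ^ \<alpha>2) * (1 - t ^ \<alpha>21) *
               (\<Sum>j = 0..\<alpha>4 - 2. t ^ (j * \<alpha>2 + (\<alpha>4 - 1 - j))))"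
proof -
  obtain g where g: "\<alpha>1 = \<alpha>21 + 1 + g" "0 < g"
    using alpha(1,6) by (intro that[of "\<alpha>1 - \<alpha>21 - 1"]) auto
  obtain b where b: "\<alpha>2 = b + 1" "\<alpha>21 < b"
    using alpha(2) alpha2 by (intro that[of "\<alpha>2 - 1"]) auto
  obtain c where c: "\<alpha>3 = c + 1" "0 < c"
    using alpha(3) by (intro that[of "\<alpha>3 - 1"]) auto
  obtain d where d: "\<alpha>4 = d + 1" "0 < d"
    using alpha(4) by (intro that[of "\<alpha>4 - 1"]) auto
  have n1': "n1 = (b + 1) * (c + 1) * d + 1"
    unfolding n1 b c d by simp
  have n2': "n2 = \<alpha>21 * (c + 1) * (d + 1) + g * c + (c + 1)"
    unfolding n2 g c d by simp
  have n3': "n3 = (\<alpha>21 + g) * (d + 1) + 1 + g * b * d"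
    unfolding n3 g b d by (simp add: algebra_simps)
  have n4': "n4 = (\<alpha>21 + 1 + g) * (b + 1) * c + \<alpha>21 * b + b + 1"
    unfolding n4 g b c by simp
  interpret K: komeda_semigroup n1 n2 n3 n4 \<alpha>1 \<alpha>2 \<alpha>3 g b c d \<alpha>21
  proof unfold_locales
    show "\<alpha>1 * n1 = n3 + d * n4" "\<alpha>2 * n2 = \<alpha>21 * n1 + n4" "\<alpha>3 * n3 = g * n1 + n2"
      "(d + 1) * n4 = n1 + b * n2 + c * n3" "(\<alpha>21 + 1) * n1 + c * n3 = n2 + d * n4"
      unfolding n1' n2' n3' n4' g b c by (simp_all add: algebra_simps)
    show "n1 = \<alpha>2 * \<alpha>3 * d + 1" unfolding n1' b c ..
  qed (use order gcd alpha g b c d in simp_all)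
  have s: "K.s = s"
    unfolding K.s_def s d ..
  have "d < \<alpha>21 + c"
    using s_index_0_bound[of \<alpha>21 b d c g] order(2,4) alpha(5) b(2) d(2) unfolding n1' n2' n3' n4' by simp
  then have s0: "K.s 0 = 0"
    unfolding K.s_def s_index_def by (intro Least_eq_0) (simp add: c)
  have "hilbert_series R \<mm> = count_gf K.standard K.deg"
    unfolding hilbert_series_def count_gf_def R \<mm> K.card_order_eq[symmetric]
    using order by (subst hilbert_function_semigroup_ring) auto
  moreover have "(1 - t) ^ 4 * (P / (1 - t) ^ 4) = P"
  proof -
    have unit: "fps_nth ((1 - t) ^ 4) 0 \<noteq> 0" by (simp add: t)
    have "(1 - t) ^ 4 * (P / (1 - t) ^ 4) = P * ((1 - t) ^ 4 * inverse ((1 - t) ^ 4))"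
      by (simp only: fps_divide_unit[OF unit] mult_ac)
    then show ?thesis by (simp only: inverse_mult_eq_1'[OF unit] mult_1_right)
  qed
  ultimately have P': "P = (1 - t) ^ 4 * count_gf K.standard K.deg" using P by simp
  have set: "{0..\<alpha>4 - 2} = {..<d}" using d by auto
  have H: "(\<Sum>j = 0..\<alpha>4 - 2. t ^ (((\<alpha>4 - 1) * s j + j) * \<alpha>2 + \<alpha>4 - j))
      = (\<Sum>i<d. t ^ ((d * s i + i) * \<alpha>2 + 1 + (d - i)))"
    unfolding set by (intro sum.cong[OF refl] arg_cong[of _ _ "\<lambda>k. t ^ k"]) (simp add: d)
  show ?thesis
    unfolding P' K.hilbert_numerator[OF t s0] unfolding H unfolding set s
    using d by (simp add: c(1))
qed

end
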